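(* Let $p\ge2$ be an integer, $r_0,r_2,\varepsilon_0,\delta>0$ with $\delta$ sufficiently small, $D_1=D(0,r_0)$, $D_2=D(0,r_2)$, $\Sigma=S(-\delta,\delta,\varepsilon_0)$, and let $P$ be a bounded analytic function on $D_1\times D_2\times\Sigma$ which is Gevrey of order $1$ in $\varepsilon\in\Sigma$. Let $V=V(\alpha,\beta,\infty,\mu)$ with $\mu$ real (positive or negative) and $-\frac{3\pi}{2p}<\alpha<0<\beta<\frac{3\pi}{2p}$. Then the equation $$\varepsilon y'=p\,x^{p-1}y+\varepsilon P(x,y,\varepsilon),\qquad \varepsilon=\eta^p,$$ has a unique formal combined series solution $\hat y$ in $\eta\,\tilde C(V)$.
   Context: $D(0,r)$ is the open disc of $\mathbb C$. $S(\alpha,\beta,r)=\{x\in\mathbb C:0<|x|<r,\alpha<\arg x<\beta\}$. Quasi-sectors: for $\mu>0$, $V(\alpha,\beta,r,\mu)=\{x:(0<|x|<r,\alpha<\arg x<\beta)\text{ or }|x|<\mu\}$; for $\mu<0$, $V(\alpha,\beta,r,\mu)=\{x:-\mu<|x|<r,\alpha<\arg x<\beta\}$. $P$ Gevrey of order 1 in $\varepsilon$: there are holomorphic $P_k$ on $D_1\times D_2$ and $C,K>0$ with $|P(x,y,\varepsilon)-\sum_{k<N}P_k(x,y)\varepsilon^k|\le CK^NN!\,|\varepsilon|^N$ for all $N$ and all $(x,y,\varepsilon)$. $\tilde{\mathcal H}$: holomorphic functions on $D_1$ (not necessarily bounded). $\mathcal G(V)$: bounded holomorphic functions $g$ on $V$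 having an asymptotic expansion without constant term $g(X)\sim\sum_{\nu\ge1}g_\nu X^{-\nu}$ as $V\ni X\to\infty$. $\tilde C(V)$ is the set of formal combined series $\hat y(x,\eta)=\sum_{n\ge0}(a_n(x)+g_n(\frac x\eta))\eta^n$ with $a_n\in\tilde{\mathcal H}$, $g_n\in\mathcal G(V)$, i.e. sequences of pairs $(a_n,g_n)$; $\eta\tilde C(V)$ is the subset with $a_0=0,g_0=0$. It carries termwise addition and the $\eta$-adic topology. Product: extend $\eta$-adically and bilinearly from the pointwise products of two elements of $\tilde{\mathcal H}$, of two elements of $\mathcal G(V)$, and, for $a(x)=\sum_{\nu\ge0}a_\nu x^\nu\in\tilde{\mathcal H}$, $g\sim\sum_{\nu\ge1}g_\nu X^{-\nu}\in\mathcal G(V)$, $$a(x)\cdot g\big(\tfrac x\eta\big):=\sum_{\nu\ge0}\Big(g_\nu(\mathbf S^\nu a)(x)+a_\nu(\mathbf T^\nu g)\big(\tfrac x\eta\big)\Big)\eta^\nu,\qquad g_0:=0,$$ with $(\mathbf Sa)(x)=(a(x)-a(0))/x$ and $(\mathbf Tg)(X)=Xg(X)-g_1$. For $\hat y\in\eta\tilde C(V)$, $P(x,\hat y,\eta^p):=\sum_{j,k\ge0}p_{jk}(x)\,\hat y^{\,j}\eta^{pk}$ where $P_k(x,y)=\sum_jp_{jk}(x)y^j$ (the sum converges $\eta$-adically). The derivative is $\eta^p\hat y'=\sum_n\big(a_n'(x)\eta^{n+p}+g_n'(\frac x\eta)\eta^{n+p-1}\big)$. A formal combined series solution is $\hat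 y$ for which both sides of the equation coincide coefficient by coefficient (slow parts as functions of $x$, fast parts as functions of $X=x/\eta$). *)

theory Defs
  imports "HOL-Complex_Analysis.Complex_Analysis"
    "HOL-Library.Landau_Symbols"
    "HOL-Library.Function_Algebras"
begin

definition sector :: "real \<Rightarrow> real \<Rightarrow> ereal \<Rightarrow> complex set" where
  "sector \<alpha> \<beta> r =
     {x. 0 < norm x \<and> ereal (norm x) < r \<and> (\<exists>\<theta>. is_Arg x \<theta> \<and> \<alpha> < \<theta> \<and> \<theta> < \<beta>)}"

(* The second branch is meant for \<mu> < 0; \<mu> = 0 is never used. *)
definition quasi_sector :: "real \<Rightarrow> real \<Rightarrow> ereal \<Rightarrow> real \<Rightarrow> complex set" where
  "quasi_sector \<alpha> \<beta> r \<mu> =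
     (if 0 < \<mu> then {x. x \<in> sector \<alpha> \<beta> r \<or> norm x < \<mu>}
      else {x. x \<in> sector \<alpha> \<beta> r \<and> - \<mu> < norm x})"

(* Holomorphy in several variables: a complex-linear Frechet derivative at every point of an
   open set. *)
definition holomorphic2_on :: "(complex \<times> complex \<Rightarrow> complex) \<Rightarrow> (complex \<times> complex) set \<Rightarrow> bool"
  where
  "holomorphic2_on f U \<longleftrightarrow> open U \<and>
     (\<forall>z\<in>U. \<exists>a b. (f has_derivative (\<lambda>(h, k). a * h + b * k)) (at z))"

definition holomorphic3_on ::
  "(complex \<times> complex \<times> complex \<Rightarrow> complex) \<Rightarrow> (complex \<times> complex \<times> complex) set \<Rightarrow> bool"
  where
  "holomorphic3_on f U \<longleftrightarrow> open U \<and>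
     (\<forall>z\<in>U. \<exists>a b c. (f has_derivative (\<lambda>(h, k, l). a * h + b * k + c * l)) (at z))"

(* The coefficients Q k = P_k are determined by P as soon as 0 is a limit point of \<Sigma>. *)
definition gevrey1_expansion ::
  "complex set \<Rightarrow> complex set \<Rightarrow> complex set \<Rightarrow> (complex \<times> complex \<times> complex \<Rightarrow> complex) \<Rightarrow>
   (nat \<Rightarrow> complex \<times> complex \<Rightarrow> complex) \<Rightarrow> bool" where
  "gevrey1_expansion D1 D2 \<Sigma> P Q \<longleftrightarrow>
     (\<forall>k. holomorphic2_on (Q k) (D1 \<times> D2)) \<and>
     (\<exists>C>0. \<exists>K>0. \<forall>N. \<forall>x\<in>D1. \<forall>y\<in>D2. \<forall>e\<in>\<Sigma>.
        norm (P (x, y, e) - (\<Sum>k<N. Q k (x, y) * e ^ k)) \<le> C * K ^ N * fact N * norm e ^ N)"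

(* g(X) ~ sum of c \<nu> X^(-\<nu>) over \<nu> \<ge> 1, for X \<rightarrow> \<infinity> in V.  The normalisation c 0 = 0 encodes the absent
   constant term and makes c unique when V is unbounded. *)
definition has_asymptotics :: "complex set \<Rightarrow> (complex \<Rightarrow> complex) \<Rightarrow> (nat \<Rightarrow> complex) \<Rightarrow> bool" where
  "has_asymptotics V g c \<longleftrightarrow> c 0 = 0 \<and>
     (\<forall>N. (\<lambda>X. g X - (\<Sum>\<nu><N. c \<nu> / X ^ \<nu>)) \<in> O[inf at_infinity (principal V)](\<lambda>X. 1 / X ^ N))"

definition asym_coeff :: "complex set \<Rightarrow> (complex \<Rightarrow> complex) \<Rightarrow> nat \<Rightarrow> complex" where
  "asym_coeff V g = (THE c. has_asymptotics V g c)"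

definition fast_space :: "complex set \<Rightarrow> (complex \<Rightarrow> complex) set" where
  "fast_space V =
     {g. g holomorphic_on V \<and> bounded (g ` V) \<and> (\<exists>c. has_asymptotics V g c)}"

definition taylor_coeff :: "(complex \<Rightarrow> complex) \<Rightarrow> nat \<Rightarrow> complex" where
  "taylor_coeff a \<nu> = (deriv ^^ \<nu>) a 0 / fact \<nu>"

(* At x = 0 the quotient is understood as its holomorphic extension. *)
definition shift_S :: "(complex \<Rightarrow> complex) \<Rightarrow> complex \<Rightarrow> complex" where
  "shift_S a x = (if x = 0 then deriv a 0 else (a x - a 0) / x)"

definition shift_T :: "complex set \<Rightarrow> (complex \<Rightarrow> complex) \<Rightarrow> complex \<Rightarrow> complex" where
  "shift_T V g X = X * g X - asym_coeff V g 1"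

(* The n-th entry (a, g) is the coefficient a(x) + g(x/\<eta>) of \<eta>^n.  Slow parts are only relevant on
   the disc D1 and fast parts only on V: all operations below are compatible with cs_eq, which is
   the equality of formal combined series. *)
type_synonym combined_series = "nat \<Rightarrow> (complex \<Rightarrow> complex) \<times> (complex \<Rightarrow> complex)"

definition cs_eq :: "complex set \<Rightarrow> complex set \<Rightarrow> combined_series \<Rightarrow> combined_series \<Rightarrow> bool" where
  "cs_eq D1 V y z \<longleftrightarrow>
     (\<forall>n. (\<forall>x\<in>D1. fst (y n) x = fst (z n) x) \<and> (\<forall>X\<in>V. snd (y n) X = snd (z n) X))"

definition cs_space :: "complex set \<Rightarrow> complex set \<Rightarrow> combined_series set" where
  "cs_space D1 V = {y. \<forall>n. fst (y n) holomorphic_on D1 \<and> snd (y n) \<in> fast_space V}"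

definition eta_cs_space :: "complex set \<Rightarrow> complex set \<Rightarrow> combined_series set" where
  "eta_cs_space D1 V =
     {y \<in> cs_space D1 V. (\<forall>x\<in>D1. fst (y 0) x = 0) \<and> (\<forall>X\<in>V. snd (y 0) X = 0)}"

definition cs_slow :: "(complex \<Rightarrow> complex) \<Rightarrow> combined_series" where
  "cs_slow a n = (if n = 0 then (a, 0) else 0)"

definition eta_shift :: "nat \<Rightarrow> combined_series \<Rightarrow> combined_series" where
  "eta_shift k y n = (if n < k then 0 else y (n - k))"

definition slow_times_fast ::
  "complex set \<Rightarrow> (complex \<Rightarrow> complex) \<Rightarrow> (complex \<Rightarrow> complex) \<Rightarrow> combined_series" where
  "slow_times_fast V a g \<nu> =
     (\<lambda>x. asym_coeff V g \<nu> * (shift_S ^^ \<nu>) a x, \<lambda>X. taylor_coeff a \<nu> * (shift_T V ^^ \<nu>) g X)"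

(* (a(x) + g(x/\<eta>)) * (b(x) + h(x/\<eta>)) *)
definition entry_mult ::
  "complex set \<Rightarrow> (complex \<Rightarrow> complex) \<times> (complex \<Rightarrow> complex) \<Rightarrow>
   (complex \<Rightarrow> complex) \<times> (complex \<Rightarrow> complex) \<Rightarrow> combined_series" where
  "entry_mult V = (\<lambda>(a, g) (b, h).
     (\<lambda>\<nu>. if \<nu> = 0 then (\<lambda>x. a x * b x, \<lambda>X. g X * h X) else 0)
     + slow_times_fast V a h + slow_times_fast V b g)"

definition cs_mult :: "complex set \<Rightarrow> combined_series \<Rightarrow> combined_series \<Rightarrow> combined_series" where
  "cs_mult V y z n = (\<Sum>i\<le>n. \<Sum>j\<le>n - i. entry_mult V (y i) (z j) (n - i - j))"

primrec cs_power :: "complex set \<Rightarrow> combined_series \<Rightarrow> nat \<Rightarrow> combined_series" where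
  "cs_power V y 0 = cs_slow (\<lambda>x. 1)"
| "cs_power V y (Suc j) = cs_mult V y (cs_power V y j)"

(* p_jk(x), the coefficient of y^j in Q k (x, y) *)
definition y_coeff :: "(nat \<Rightarrow> complex \<times> complex \<Rightarrow> complex) \<Rightarrow> nat \<Rightarrow> nat \<Rightarrow> complex \<Rightarrow> complex" where
  "y_coeff Q j k x = taylor_coeff (\<lambda>y. Q k (x, y)) j"

(* The \<eta>-adic sum over all j, k of p_jk(x) y^j \<eta>^(pk), for y without term of order 0: since y^j then
   starts at order j, only the finitely many (j, k) with j + p k \<le> n reach order n. *)
definition cs_subst ::
  "complex set \<Rightarrow> nat \<Rightarrow> (nat \<Rightarrow> complex \<times> complex \<Rightarrow> complex) \<Rightarrow> combined_series \<Rightarrow> combined_series"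
  where
  "cs_subst V p Q y n =
     (\<Sum>(j, k)\<in>{(j, k). j + p * k \<le> n}.
        eta_shift (p * k) (cs_mult V (cs_slow (y_coeff Q j k)) (cs_power V y j)) n)"

(* \<eta>^p y' : a slow part is differentiated in x, and d/dx of g(x/\<eta>) is \<eta>^(-1) g'(x/\<eta>). *)
definition eta_pow_deriv :: "nat \<Rightarrow> combined_series \<Rightarrow> combined_series" where
  "eta_pow_deriv p y =
     eta_shift p (\<lambda>n. (deriv (fst (y n)), 0)) + eta_shift (p - 1) (\<lambda>n. (0, deriv (snd (y n))))"

(* \<epsilon> y' = p x^(p-1) y + \<epsilon> P(x, y, \<epsilon>) with \<epsilon> = \<eta>^p, where Q is the coefficient sequence of P. *)
definition formal_solution ::
  "complex set \<Rightarrow> complex set \<Rightarrow> nat \<Rightarrow> (nat \<Rightarrow> complex \<times> complex \<Rightarrow> complex) \<Rightarrow> combined_series \<Rightarrow> bool"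
  where
  "formal_solution D1 V p Q y \<longleftrightarrow>
     cs_eq D1 V (eta_pow_deriv p y)
       (cs_mult V (cs_slow (\<lambda>x. of_nat p * x ^ (p - 1))) y + eta_shift p (cs_subst V p Q y))"

end

(* Compare coefficients of \<eta>^n. Multiplication of g(x/\<eta>) by p x^(p-1) leaves p T^(p-1) g in the fast
   part and the polynomial p (g_1 x^(p-2) + ... + g_(p-1)), spread over the orders n+1, ..., n+p-1, in
   the slow part. So the slow equations express a_n algebraically by earlier data, and they are
   solvable by a holomorphic a_n iff g_1, ..., g_(p-1) of each fast part have prescribed values.
   The fast equation is then g' = p X^(p-1) g - p (b_1 X^(p-2) + ... + b_(p-1)) + G with known b and
   G. Its solution is -\<integral> exp(X^p - t^p) f(t) dt from X to infinity; the path is chosen such that t^p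
   runs along a ray in the half plane Re > 0. As |p arg X| < 3\<pi>/2, a direction of the ray at an angle
   less than \<pi> to X^p exists, so the path stays in V and away from 0. This bounds the remainders of
   the asymptotic expansion, and all other solutions grow like exp(X^p) on the positive axis. *)

theory Submission
  imports Defs "HOL-Real_Asymp.Real_Asymp"
begin

section \<open>Asymptotic expansions at infinity\<close>

text \<open>No integral along a path is formed. One primitive of exp(-t^p) f(t) is fixed on all of V
  and normalised to vanish at infinity on the positive axis; paths serve only to estimate it. If s
  is a partial sum of the expansion, then this primitive minus exp(-X^p) s is again such a
  primitive, with an integrand of small order. So one decay estimate, applied for every order, gives
  both the expansion and the bound near infinity. The induction on the order closes by an index
  count. The coefficient g_\<nu> of the fast part of order n, 0 < \<nu> < p, enters the slow
  equation of order n+\<nu>, whose residual involves only orders up to n+\<nu>-p, which is less than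
  n. So the values of g_1, ..., g_(p-1) are known before the fast equation of order n is solved.
  That equation has no free constant left to meet them, as its homogeneous solutions are unbounded.
  They are met because the formal expansion of a solution has to cancel the polynomial with the
  coefficients b_1, ..., b_(p-1), and hence starts with exactly these numbers.\<close>

abbreviation infinity_in :: "complex set \<Rightarrow> complex filter" where
  "infinity_in V \<equiv> inf at_infinity (principal V)"

lemma eventually_infinity_in:
  "eventually P (infinity_in V) \<longleftrightarrow> (\<exists>R. \<forall>X\<in>V. R \<le> norm X \<longrightarrow> P X)"
  unfolding eventually_inf_principal eventually_at_infinity by auto

lemma eventually_infinity_in_nonzero: "eventually (\<lambda>X. X \<noteq> 0) (infinity_in V)"
  unfolding eventually_infinity_in by (rule exI[of _ 1]) auto

lemma filterlim_infinity_in: "filterlim (\<lambda>X. X) at_infinity (infinity_in V)"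
  by (simp add: filterlim_def filtermap_ident)

lemma inverse_power_bigo:
  assumes "m \<le> n"
  shows "(\<lambda>X::complex. 1 / X ^ n) \<in> O[infinity_in V](\<lambda>X. 1 / X ^ m)"
proof (rule bigoI[of _ 1])
  show "\<forall>\<^sub>F X in infinity_in V. norm (1 / X ^ n :: complex) \<le> 1 * norm (1 / X ^ m)"
    unfolding eventually_infinity_in
  proof (intro exI[of _ 1] ballI impI)
    fix X :: complex assume "X \<in> V" "1 \<le> norm X"
    then have "norm X ^ m \<le> norm X ^ n" "norm X ^ m > 0"
      using assms power_increasing by (auto intro!: zero_less_power)
    then show "norm (1 / X ^ n :: complex) \<le> 1 * norm (1 / X ^ m)"
      by (simp add: norm_divide norm_power frac_le)
  qed
qed

text \<open>V reaches its finite boundary, so holomorphy on V gives no bound on the bounded parts of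
  V. They have to be controlled separately; the expansion takes care of the rest.\<close>

lemma bounded_if_bigo_1:
  assumes "g \<in> O[infinity_in V](\<lambda>X. 1)"
    and "\<And>R. bounded (g ` {X\<in>V. norm X \<le> R})"
  shows "bounded (g ` V)"
proof -
  obtain c where "\<forall>\<^sub>F X in infinity_in V. norm (g X) \<le> c * norm (1::complex)"
    using assms(1) by (elim landau_o.bigE) auto
  then obtain R where R: "\<And>X. X \<in> V \<Longrightarrow> R \<le> norm X \<Longrightarrow> norm (g X) \<le> c"
    unfolding eventually_infinity_in by auto
  have "bounded (g ` {X\<in>V. R \<le> norm X})"
    using R by (auto simp: bounded_iff)
  then have "bounded (g ` {X\<in>V. norm X \<le> R} \<union> g ` {X\<in>V. R \<le> norm X})"
    using assms(2) by simp
  then show ?thesis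
    by (rule bounded_subset) (auto simp: image_iff, metis linear)
qed

lemma has_asymptotics_cong:
  assumes "\<And>X. X \<in> V \<Longrightarrow> g X = h X"
  shows "has_asymptotics V g c = has_asymptotics V h c"
proof -
  have "\<forall>\<^sub>F X in infinity_in V. g X = h X"
    unfolding eventually_infinity_in using assms by auto
  then show ?thesis
    unfolding has_asymptotics_def
    by (intro conj_cong refl arg_cong[where f = All] ext landau_o.big.in_cong) (auto elim: eventually_mono)
qed

lemma asym_coeff_cong:
  assumes "\<And>X. X \<in> V \<Longrightarrow> g X = h X"
  shows "asym_coeff V g = asym_coeff V h"
proof -
  have "has_asymptotics V g = has_asymptotics V h"
    using has_asymptotics_cong[of V g h, OF assms] by (intro ext)
  then show ?thesis
    by (simp add: asym_coeff_def)
qed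

lemma has_asymptotics_D:
  assumes "has_asymptotics V g c"
  shows "(\<lambda>X. g X - (\<Sum>\<nu><N. c \<nu> / X ^ \<nu>)) \<in> O[infinity_in V](\<lambda>X. 1 / X ^ N)"
  using assms by (simp add: has_asymptotics_def)

lemma has_asymptotics_bigo_1:
  assumes "has_asymptotics V g c"
  shows "g \<in> O[infinity_in V](\<lambda>X. 1)"
  using has_asymptotics_D[OF assms, of 0] by simp

lemma has_asymptotics_tail:
  assumes "has_asymptotics V g c" "N \<le> M"
  shows "(\<lambda>X. g X - (\<Sum>\<nu><M. c \<nu> / X ^ \<nu>)) \<in> O[infinity_in V](\<lambda>X. 1 / X ^ N)"
  using landau_o.big.trans[OF has_asymptotics_D[OF assms(1), of M] inverse_power_bigo[OF assms(2)]] .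

lemma sum_tail_bigo:
  fixes c :: "'i \<Rightarrow> complex"
  assumes "\<And>i. i \<in> I \<Longrightarrow> N \<le> e i"
  shows "(\<lambda>X. \<Sum>i\<in>I. c i / X ^ e i) \<in> O[infinity_in V](\<lambda>X. 1 / X ^ N)"
proof (intro big_sum_in_bigo)
  fix i assume "i \<in> I"
  then have "(\<lambda>X::complex. 1 / X ^ e i) \<in> O[infinity_in V](\<lambda>X. 1 / X ^ N)"
    by (intro inverse_power_bigo assms)
  then have "(\<lambda>X. c i * (1 / X ^ e i)) \<in> O[infinity_in V](\<lambda>X. 1 / X ^ N)"
    by (cases "c i = 0") (simp, rule landau_o.big.cmult_in_iff[THEN iffD2])
  then show "(\<lambda>X. c i / X ^ e i) \<in> O[infinity_in V](\<lambda>X. 1 / X ^ N)"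
    unfolding times_divide_eq_right mult_1_right .
qed

lemma has_asymptotics_zero: "has_asymptotics V (\<lambda>X. 0) (\<lambda>\<nu>. 0)"
  by (simp add: has_asymptotics_def)

lemma has_asymptotics_add:
  assumes "has_asymptotics V g c" "has_asymptotics V h d"
  shows "has_asymptotics V (\<lambda>X. g X + h X) (\<lambda>\<nu>. c \<nu> + d \<nu>)"
  unfolding has_asymptotics_def
proof (intro conjI allI)
  fix N
  show "(\<lambda>X. g X + h X - (\<Sum>\<nu><N. (c \<nu> + d \<nu>) / X ^ \<nu>)) \<in> O[infinity_in V](\<lambda>X. 1 / X ^ N)"
    using sum_in_bigo(1)[OF assms[THEN has_asymptotics_D, of N]]
    by (simp add: add_divide_distrib sum.distrib algebra_simps)
qed (use assms in \<open>simp add: has_asymptotics_def\<close>)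

lemma has_asymptotics_cmult:
  assumes "has_asymptotics V g c"
  shows "has_asymptotics V (\<lambda>X. k * g X) (\<lambda>\<nu>. k * c \<nu>)"
  unfolding has_asymptotics_def
proof (intro conjI allI)
  fix N
  have "(\<lambda>X. k * (g X - (\<Sum>\<nu><N. c \<nu> / X ^ \<nu>))) \<in> O[infinity_in V](\<lambda>X. 1 / X ^ N)"
    using has_asymptotics_D[OF assms, of N] by (cases "k = 0") auto
  then show "(\<lambda>X. k * g X - (\<Sum>\<nu><N. k * c \<nu> / X ^ \<nu>)) \<in> O[infinity_in V](\<lambda>X. 1 / X ^ N)"
    by (simp add: sum_distrib_left algebra_simps)
qed (use assms in \<open>simp add: has_asymptotics_def\<close>)

text \<open>With s and t the partial sums of g and h, g h - s t = (g - s) h + s (h - t), where h and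
  s are bounded near infinity. The product s t differs from the N-th Cauchy partial sum only by
  terms with exponent i+j at least N.\<close>

lemma has_asymptotics_mult:
  assumes g: "has_asymptotics V g c" and h: "has_asymptotics V h d"
  shows "has_asymptotics V (\<lambda>X. g X * h X) (\<lambda>n. \<Sum>i\<le>n. c i * d (n - i))"
  unfolding has_asymptotics_def
proof (intro conjI allI)
  fix N
  let ?s = "\<lambda>X. \<Sum>\<nu><N. c \<nu> / X ^ \<nu>" and ?t = "\<lambda>X. \<Sum>\<nu><N. d \<nu> / X ^ \<nu>"
  let ?T = "{(i, j). i + j < N}"
  have s1: "?s \<in> O[infinity_in V](\<lambda>X. 1)"
    using sum_tail_bigo[of "{..<N}" 0 "\<lambda>\<nu>. \<nu>" c V] by simp
  have 1: "(\<lambda>X. (g X - ?s X) * h X) \<in> O[infinity_in V](\<lambda>X. 1 / X ^ N)"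
    using landau_o.big.mult[OF has_asymptotics_D[OF g, of N] has_asymptotics_bigo_1[OF h]] by simp
  have 2: "(\<lambda>X. ?s X * (h X - ?t X)) \<in> O[infinity_in V](\<lambda>X. 1 / X ^ N)"
    using landau_o.big.mult[OF s1 has_asymptotics_D[OF h, of N]] by simp
  have 3: "(\<lambda>X. \<Sum>(i, j)\<in>{..<N} \<times> {..<N} - ?T. c i * d j / X ^ (i + j))
             \<in> O[infinity_in V](\<lambda>X. 1 / X ^ N)"
    using sum_tail_bigo[of "{..<N} \<times> {..<N} - ?T" N "\<lambda>(i, j). i + j" "\<lambda>(i, j). c i * d j" V]
    by (simp add: case_prod_beta')
  have eq: "?s X * ?t X - (\<Sum>n<N. (\<Sum>i\<le>n. c i * d (n - i)) / X ^ n)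
      = (\<Sum>(i, j)\<in>{..<N} \<times> {..<N} - ?T. c i * d j / X ^ (i + j))" for X
  proof -
    have "?s X * ?t X = (\<Sum>(i, j)\<in>{..<N} \<times> {..<N}. c i * d j / X ^ (i + j))"
      by (simp add: sum_product sum.cartesian_product power_add)
    moreover have "(\<Sum>n<N. (\<Sum>i\<le>n. c i * d (n - i)) / X ^ n)
        = (\<Sum>(i, j)\<in>?T. c i * d j / X ^ (i + j))"
      unfolding sum.triangle_reindex by (simp add: sum_divide_distrib)
    moreover have "?T \<subseteq> {..<N} \<times> {..<N}"
      by auto
    ultimately show ?thesis
      by (simp add: sum_diff)
  qed
  have "(\<lambda>X. (g X - ?s X) * h X + ?s X * (h X - ?t X)
      + (?s X * ?t X - (\<Sum>n<N. (\<Sum>i\<le>n. c i * d (n - i)) / X ^ n))) \<in> O[infinity_in V](\<lambda>X. 1 / X ^ N)"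
    unfolding eq by (intro sum_in_bigo(1) 1 2 3)
  then show "(\<lambda>X. g X * h X - (\<Sum>n<N. (\<Sum>i\<le>n. c i * d (n - i)) / X ^ n))
      \<in> O[infinity_in V](\<lambda>X. 1 / X ^ N)"
    by (simp add: algebra_simps)
qed (use assms in \<open>simp add: has_asymptotics_def\<close>)

text \<open>Multiplication by X costs one order: the estimate of order N+1 for the shifted function
  comes from the estimate of order N+2 for g. Order 0 then follows from order 1.\<close>

lemma has_asymptotics_shift:
  assumes "has_asymptotics V g c"
  shows "has_asymptotics V (\<lambda>X. X * g X - c 1) (\<lambda>\<nu>. if \<nu> = 0 then 0 else c (Suc \<nu>))"
    (is "has_asymptotics V ?h ?d")
proof -
  have pos: "(\<lambda>X. ?h X - (\<Sum>\<nu><Suc N. ?d \<nu> / X ^ \<nu>)) \<in> O[infinity_in V](\<lambda>X. 1 / X ^ Suc N)" for N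
  proof -
    have "(\<lambda>X. X * (g X - (\<Sum>\<nu><Suc (Suc N). c \<nu> / X ^ \<nu>))) \<in> O[infinity_in V](\<lambda>X. X * (1 / X ^ Suc (Suc N)))"
      by (rule landau_o.big.mult[OF landau_o.big_refl has_asymptotics_D[OF assms]])
    also have "(\<lambda>X. X * (1 / X ^ Suc (Suc N))) \<in> \<Theta>[infinity_in V](\<lambda>X. 1 / X ^ Suc N)"
      by (rule bigthetaI_cong, rule eventually_mono[OF eventually_infinity_in_nonzero])
         (simp add: field_simps)
    also have "(\<lambda>X. X * (g X - (\<Sum>\<nu><Suc (Suc N). c \<nu> / X ^ \<nu>))) \<in> O[infinity_in V](\<lambda>X. 1 / X ^ Suc N)
        \<longleftrightarrow> (\<lambda>X. ?h X - (\<Sum>\<nu><Suc N. ?d \<nu> / X ^ \<nu>)) \<in> O[infinity_in V](\<lambda>X. 1 / X ^ Suc N)"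
    proof (rule landau_o.big.in_cong, rule eventually_mono[OF eventually_infinity_in_nonzero])
      fix X :: complex assume "X \<noteq> 0"
      then have "X * (\<Sum>\<nu><Suc (Suc N). c \<nu> / X ^ \<nu>) = c 1 + (\<Sum>\<nu><Suc N. ?d \<nu> / X ^ \<nu>)"
        using assms by (simp add: sum.lessThan_Suc_shift has_asymptotics_def sum_distrib_left
            distrib_left field_simps del: sum.lessThan_Suc)
      then show "X * (g X - (\<Sum>\<nu><Suc (Suc N). c \<nu> / X ^ \<nu>)) = ?h X - (\<Sum>\<nu><Suc N. ?d \<nu> / X ^ \<nu>)"
        by (simp add: right_diff_distrib)
    qed
    finally show ?thesis .
  qed
  show ?thesis
    unfolding has_asymptotics_def
  proof (intro conjI allI)
    fix N
    show "(\<lambda>X. ?h X - (\<Sum>\<nu><N. ?d \<nu> / X ^ \<nu>)) \<in> O[infinity_in V](\<lambda>X. 1 / X ^ N)"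
    proof (cases N)
      case 0
      then show ?thesis
        using landau_o.big.trans[OF pos[of 0] inverse_power_bigo[of 0 "Suc 0"]] by simp
    qed (use pos in simp)
  qed simp
qed

lemma tendsto_0_bigo:
  fixes f g :: "_ \<Rightarrow> complex"
  assumes "f \<in> O[F](g)" "(g \<longlongrightarrow> 0) F"
  shows "(f \<longlongrightarrow> 0) F"
proof -
  obtain c where "\<forall>\<^sub>F x in F. norm (f x) \<le> c * norm (g x)"
    using assms(1) by (elim landau_o.bigE)
  moreover have "((\<lambda>x. c * norm (g x)) \<longlongrightarrow> 0) F"
    using tendsto_mult_right_zero[OF tendsto_norm_zero[OF assms(2)]] .
  ultimately show ?thesis
    by (rule Lim_null_comparison)
qed

text \<open>If the expansions agree below n, the constant c_n - d_n is O(1/X) and so tends to 0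
  along the filter; a nontrivial filter forces it to be 0.\<close>

lemma has_asymptotics_unique:
  assumes ne: "infinity_in V \<noteq> bot" and c: "has_asymptotics V g c" and d: "has_asymptotics V g d"
  shows "c = d"
proof
  fix n show "c n = d n"
  proof (induction n rule: less_induct)
    case (less n)
    have "(\<lambda>X. (g X - (\<Sum>\<nu><Suc n. d \<nu> / X ^ \<nu>)) - (g X - (\<Sum>\<nu><Suc n. c \<nu> / X ^ \<nu>)))
        \<in> O[infinity_in V](\<lambda>X. 1 / X ^ Suc n)"
      by (intro sum_in_bigo has_asymptotics_D c d)
    moreover have "(\<Sum>\<nu><n. c \<nu> / X ^ \<nu>) = (\<Sum>\<nu><n. d \<nu> / X ^ \<nu>)" for X
      by (rule sum.cong) (auto simp: less)
    ultimately have "(\<lambda>X. (c n - d n) / X ^ n) \<in> O[infinity_in V](\<lambda>X. 1 / X ^ Suc n)"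
      by (simp add: diff_divide_distrib)
    then have "(\<lambda>X. X ^ n * ((c n - d n) / X ^ n)) \<in> O[infinity_in V](\<lambda>X. X ^ n * (1 / X ^ Suc n))"
      by (rule landau_o.big.mult[OF landau_o.big_refl])
    also have "(\<lambda>X. X ^ n * (1 / X ^ Suc n)) \<in> \<Theta>[infinity_in V](\<lambda>X. 1 / X)"
      by (rule bigthetaI_cong, rule eventually_mono[OF eventually_infinity_in_nonzero])
         (simp add: field_simps)
    also have "(\<lambda>X. X ^ n * ((c n - d n) / X ^ n)) \<in> O[infinity_in V](\<lambda>X. 1 / X) \<longleftrightarrow>
       (\<lambda>X. c n - d n) \<in> O[infinity_in V](\<lambda>X. 1 / X)"
      by (rule landau_o.big.in_cong, rule eventually_mono[OF eventually_infinity_in_nonzero])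
         simp
    finally have *: "(\<lambda>X. c n - d n) \<in> O[infinity_in V](\<lambda>X. 1 / X)" .
    have "((\<lambda>X. inverse X) \<longlongrightarrow> (0::complex)) (infinity_in V)"
      by (rule tendsto_compose[OF _ ]) (use filterlim_compose[OF tendsto_inverse_0 filterlim_infinity_in] in auto)
    then have "((\<lambda>X. 1 / X) \<longlongrightarrow> (0::complex)) (infinity_in V)"
      by (simp add: inverse_eq_divide)
    then have "((\<lambda>X. c n - d n) \<longlongrightarrow> 0) (infinity_in V)"
      by (rule tendsto_0_bigo[OF *])
    then show ?case
      using ne tendsto_const_iff[of "infinity_in V" "c n - d n" 0] by auto
  qed
qed

lemma asym_coeff_eqI:
  assumes "infinity_in V \<noteq> bot" "has_asymptotics V g c"
  shows "asym_coeff V g = c"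
  unfolding asym_coeff_def using assms has_asymptotics_unique by blast

section \<open>The fast space and the operator T\<close>

lemma fast_space_asymptotics:
  assumes "infinity_in V \<noteq> bot" "g \<in> fast_space V"
  shows "has_asymptotics V g (asym_coeff V g)"
  using assms asym_coeff_eqI by (auto simp: fast_space_def)

lemma asym_coeff_0:
  assumes "infinity_in V \<noteq> bot" "g \<in> fast_space V"
  shows "asym_coeff V g 0 = 0"
  using fast_space_asymptotics[OF assms] by (simp add: has_asymptotics_def)

lemma fast_space_zero: "(\<lambda>X. 0) \<in> fast_space V"
  unfolding fast_space_def using has_asymptotics_zero by (auto simp: image_constant_conv)

lemma fast_space_add:
  assumes "g \<in> fast_space V" "h \<in> fast_space V"
  shows "(\<lambda>X. g X + h X) \<in> fast_space V"
  using assms has_asymptotics_add[of V g _ h] bounded_plus_comp[of g V h]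
  unfolding fast_space_def by (auto intro!: holomorphic_intros)

lemma fast_space_cmult:
  assumes "g \<in> fast_space V"
  shows "(\<lambda>X. k * g X) \<in> fast_space V"
proof -
  have "bounded ((\<lambda>X. k * X) ` g ` V)"
    using assms bounded_linear_image[OF _ bounded_linear_mult_right] by (auto simp: fast_space_def)
  then show ?thesis
    using assms has_asymptotics_cmult[of V g]
    unfolding fast_space_def by (auto intro!: holomorphic_intros simp: image_image)
qed

lemma fast_space_mult:
  assumes "g \<in> fast_space V" "h \<in> fast_space V"
  shows "(\<lambda>X. g X * h X) \<in> fast_space V"
proof -
  obtain A B where AB: "\<And>X. X \<in> V \<Longrightarrow> norm (g X) \<le> A" "\<And>X. X \<in> V \<Longrightarrow> norm (h X) \<le> B"
    using assms unfolding fast_space_def bounded_iff by auto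
  have "norm (g X * h X) \<le> A * B" if "X \<in> V" for X
    unfolding norm_mult by (rule mult_mono'[OF AB(1)[OF that] AB(2)[OF that]]) auto
  then have "bounded ((\<lambda>X. g X * h X) ` V)"
    unfolding bounded_iff by auto
  then show ?thesis
    using assms has_asymptotics_mult[of V g _ h]
    unfolding fast_space_def by (auto intro!: holomorphic_intros)
qed

lemma shift_T_cong:
  assumes "\<And>X. X \<in> V \<Longrightarrow> g X = h X" "X \<in> V"
  shows "shift_T V g X = shift_T V h X"
  by (simp add: shift_T_def asym_coeff_cong[OF assms(1)] assms)

lemma shift_T_power_cong:
  assumes "\<And>X. X \<in> V \<Longrightarrow> g X = h X" "X \<in> V"
  shows "(shift_T V ^^ n) g X = (shift_T V ^^ n) h X"
  using assms(2) by (induction n arbitrary: X) (auto simp: assms(1) intro!: shift_T_cong)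

text \<open>The factor X destroys the obvious bound. Near infinity boundedness comes from the
  shifted expansion, on |X| <= R from the bound of g itself.\<close>

lemma shift_T_fast:
  assumes ne: "infinity_in V \<noteq> bot" and g: "g \<in> fast_space V"
  shows "shift_T V g \<in> fast_space V"
    and "asym_coeff V (shift_T V g) = (\<lambda>\<nu>. if \<nu> = 0 then 0 else asym_coeff V g (Suc \<nu>))"
proof -
  have as: "has_asymptotics V (shift_T V g) (\<lambda>\<nu>. if \<nu> = 0 then 0 else asym_coeff V g (Suc \<nu>))"
    unfolding shift_T_def using has_asymptotics_shift[OF fast_space_asymptotics[OF ne g]] .
  then show "asym_coeff V (shift_T V g) = (\<lambda>\<nu>. if \<nu> = 0 then 0 else asym_coeff V g (Suc \<nu>))"
    by (rule asym_coeff_eqI[OF ne])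
  obtain B where B: "\<And>X. X \<in> V \<Longrightarrow> norm (g X) \<le> B"
    using g unfolding fast_space_def bounded_iff by auto
  have "bounded (shift_T V g ` V)"
  proof (rule bounded_if_bigo_1[OF has_asymptotics_bigo_1[OF as]])
    fix R
    have "norm (shift_T V g X) \<le> R * B + norm (asym_coeff V g 1)" if "X \<in> V" "norm X \<le> R" for X
      unfolding shift_T_def
      by (rule norm_triangle_le_diff, rule add_right_mono, unfold norm_mult, rule mult_mono')
         (use that B in auto)
    then show "bounded (shift_T V g ` {X \<in> V. norm X \<le> R})"
      unfolding bounded_iff by auto
  qed
  moreover have "shift_T V g holomorphic_on V"
    using g unfolding shift_T_def[abs_def] fast_space_def by (auto intro!: holomorphic_intros)
  ultimately show "shift_T V g \<in> fast_space V"
    using as unfolding fast_space_def by auto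
qed

lemma shift_T_power_fast:
  assumes ne: "infinity_in V \<noteq> bot" and g: "g \<in> fast_space V"
  shows "(shift_T V ^^ n) g \<in> fast_space V"
    and "\<nu> > 0 \<Longrightarrow> asym_coeff V ((shift_T V ^^ n) g) \<nu> = asym_coeff V g (\<nu> + n)"
proof -
  have *: "(shift_T V ^^ n) g \<in> fast_space V \<and>
      (\<forall>\<nu>>0. asym_coeff V ((shift_T V ^^ n) g) \<nu> = asym_coeff V g (\<nu> + n))" for n
    by (induction n) (use g shift_T_fast[OF ne] in auto)
  then show "(shift_T V ^^ n) g \<in> fast_space V"
    and "\<nu> > 0 \<Longrightarrow> asym_coeff V ((shift_T V ^^ n) g) \<nu> = asym_coeff V g (\<nu> + n)"
    by auto
qed

text \<open>Each application of T removes one term of the expansion. In the explicit form, p T^(p-1)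
  g becomes p X^(p-1) g minus a polynomial, which makes the fast equation a scalar linear
  differential equation.\<close>

lemma shift_T_power_eq:
  assumes ne: "infinity_in V \<noteq> bot" and g: "g \<in> fast_space V"
  shows "(shift_T V ^^ n) g X = X ^ n * g X - (\<Sum>\<nu>=1..n. asym_coeff V g \<nu> * X ^ (n - \<nu>))"
proof (induction n)
  case (Suc n)
  have "(\<Sum>\<nu>=1..n. asym_coeff V g \<nu> * X ^ (Suc n - \<nu>)) = X * (\<Sum>\<nu>=1..n. asym_coeff V g \<nu> * X ^ (n - \<nu>))"
    unfolding sum_distrib_left by (rule sum.cong) (auto simp: Suc_diff_le)
  then show ?case
    using shift_T_power_fast(2)[OF ne g, of 1 n]
    by (simp add: Suc shift_T_def[of V "(shift_T V ^^ n) g"] algebra_simps)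
qed auto

section \<open>Quasi-sectors\<close>

text \<open>The square of the norm is (1+cos \<omega>)/2 (1+\<tau>)^2 + (1-cos \<omega>)/2
  (1-\<tau>)^2, and the second summand is dropped. The constant is cos(\<omega>0/2), which is
  positive because \<omega>0 < pi.\<close>

lemma norm_one_plus_ray:
  assumes "\<bar>\<omega>\<bar> \<le> \<omega>0" "\<omega>0 < pi" "0 \<le> \<tau>"
  shows "sqrt ((1 + cos \<omega>0) / 2) * (1 + \<tau>) \<le> norm (1 + of_real \<tau> * cis \<omega>)"
proof -
  have "cos \<omega>0 \<le> cos \<omega>"
    using cos_monotone_0_pi_le[of "\<bar>\<omega>\<bar>" \<omega>0] assms by simp
  then have "(1 + cos \<omega>0) / 2 * (1 + \<tau>)\<^sup>2 \<le> (1 + cos \<omega>) / 2 * (1 + \<tau>)\<^sup>2"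
    by (intro mult_right_mono) auto
  also have "\<dots> \<le> (1 + cos \<omega>) / 2 * (1 + \<tau>)\<^sup>2 + (1 - cos \<omega>) / 2 * (1 - \<tau>)\<^sup>2"
    using cos_le_one[of \<omega>] by simp
  also have "\<dots> = 1 + 2 * \<tau> * cos \<omega> + \<tau>\<^sup>2"
    by (simp add: power2_eq_square field_simps)
  also have "\<dots> = (1 + \<tau> * cos \<omega>)\<^sup>2 + (\<tau> * sin \<omega>)\<^sup>2"
    using sin_cos_squared_add[of \<omega>] by algebra
  also have "\<dots> = (norm (1 + of_real \<tau> * cis \<omega>))\<^sup>2"
    by (simp add: cmod_power2)
  finally have "sqrt ((1 + cos \<omega>0) / 2 * (1 + \<tau>)\<^sup>2) \<le> norm (1 + of_real \<tau> * cis \<omega>)"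
    by (rule real_le_lsqrt[rotated]) auto
  then show ?thesis
    using assms by (simp only: real_sqrt_mult real_sqrt_abs)
qed

lemma sqrt_half_one_plus_cos:
  assumes "0 \<le> \<omega>0" "\<omega>0 < pi"
  shows "0 < sqrt ((1 + cos \<omega>0) / 2)" "sqrt ((1 + cos \<omega>0) / 2) \<le> 1"
proof -
  have "cos pi < cos \<omega>0"
    using cos_monotone_0_pi[of \<omega>0 pi] assms by simp
  then show "0 < sqrt ((1 + cos \<omega>0) / 2)" "sqrt ((1 + cos \<omega>0) / 2) \<le> 1"
    by auto
qed

lemma one_plus_ray_notin_nonpos_Reals:
  assumes "\<bar>\<omega>\<bar> < pi" "0 \<le> \<tau>"
  shows "1 + of_real \<tau> * cis \<omega> \<notin> \<real>\<^sub>\<le>\<^sub>0"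
proof
  assume *: "1 + of_real \<tau> * cis \<omega> \<in> \<real>\<^sub>\<le>\<^sub>0"
  then have im: "\<tau> * sin \<omega> = 0" and re: "1 + \<tau> * cos \<omega> \<le> 0"
    by (auto simp: complex_nonpos_Reals_iff)
  then have "\<tau> \<noteq> 0"
    by auto
  then have "\<omega> = 0"
    using im assms sin_eq_0_pi[of \<omega>] by auto
  then show False
    using re assms by simp
qed

text \<open>For \<omega> >= 0, rotation by -\<omega> turns the point into e^(-i \<omega>) + \<tau>,
  whose imaginary part -sin \<omega> is not positive; an argument above \<omega> would make it
  positive. Negative \<omega> follow by conjugation. This controls the argument along the path on
  which the primitive is estimated.\<close>

lemma Arg_one_plus_ray:
  assumes "\<bar>\<omega>\<bar> < pi" "0 \<le> \<tau>"
  shows "Arg (1 + of_real \<tau> * cis \<omega>) \<in> closed_segment 0 \<omega>"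
proof -
  have pos: "0 \<le> Arg (1 + of_real \<tau> * cis \<omega>) \<and> Arg (1 + of_real \<tau> * cis \<omega>) \<le> \<omega>"
    if "0 \<le> \<omega>" "\<omega> < pi" for \<omega>
  proof -
    define z where "z = 1 + of_real \<tau> * cis \<omega>"
    have z: "z \<notin> \<real>\<^sub>\<le>\<^sub>0"
      unfolding z_def using that assms by (intro one_plus_ray_notin_nonpos_Reals) auto
    then have "z \<noteq> 0"
      by auto
    have "0 \<le> Im z"
      using that assms sin_ge_zero[of \<omega>] by (simp add: z_def)
    then have "0 \<le> Arg z"
      by (simp add: Arg_less_0)
    moreover have "Arg z \<le> \<omega>"
    proof (rule ccontr)
      assume "\<not> Arg z \<le> \<omega>"
      moreover have "Arg z < pi"
        using z Arg_le_pi[of z] Arg_eq_pi[of z] by (auto simp: complex_nonpos_Reals_iff)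
      ultimately have "0 < sin (Arg z - \<omega>)"
        using that by (intro sin_gt_zero) auto
      then have "0 < norm z * sin (Arg z - \<omega>)"
        using \<open>z \<noteq> 0\<close> by simp
      also have "\<dots> = Im (rcis (norm z) (Arg z) * cis (- \<omega>))"
        by (simp add: rcis_def sin_diff algebra_simps)
      also have "\<dots> = Im (cis (- \<omega>) + of_real \<tau> * (cis \<omega> * cis (- \<omega>)))"
        by (simp only: rcis_cmod_Arg z_def) (simp add: algebra_simps del: cis_mult)
      also have "\<dots> = - sin \<omega>"
        by (simp add: cis_mult)
      also have "\<dots> \<le> 0"
        using that by (simp add: sin_ge_zero)
      finally show False by simp
    qed
    ultimately show ?thesis
      unfolding z_def by simp
  qed
  show ?thesis
  proof (cases "0 \<le> \<omega>")
    case True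
    then show ?thesis using pos[of \<omega>] assms by (simp add: closed_segment_eq_real_ivl)
  next
    case False
    define z where "z = 1 + of_real \<tau> * cis \<omega>"
    have "1 + of_real \<tau> * cis (- \<omega>) = cnj z"
      by (simp add: z_def cis_cnj)
    then have *: "0 \<le> Arg (cnj z)" "Arg (cnj z) \<le> - \<omega>"
      using pos[of "- \<omega>"] assms False by auto
    have "z \<notin> \<real>\<^sub>\<le>\<^sub>0"
      unfolding z_def using assms by (rule one_plus_ray_notin_nonpos_Reals)
    then have "Arg z = 0" if "z \<in> \<real>"
      using that Arg_eq_0[of z] by (auto simp: complex_nonpos_Reals_iff complex_is_Real_iff)
    then have "Arg z = - Arg (cnj z)"
      by (auto simp: Arg_cnj)
    then show ?thesis
      using * False by (simp add: z_def[symmetric] closed_segment_eq_real_ivl)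
  qed
qed

section \<open>Geometry of V: principal arguments, connectedness, primitives\<close>

locale quasi_sector_equation =
  fixes p :: nat and \<alpha> \<beta> \<mu> :: real and V :: "complex set"
  assumes p_ge_2: "p \<ge> 2" and \<mu>_nonzero: "\<mu> \<noteq> 0"
    and \<alpha>_gt: "- (3 * pi / (2 * real p)) < \<alpha>" and \<alpha>_neg: "\<alpha> < 0"
    and \<beta>_pos: "0 < \<beta>" and \<beta>_less: "\<beta> < 3 * pi / (2 * real p)"
    and V_eq: "V = quasi_sector \<alpha> \<beta> \<infinity> \<mu>"
begin

text \<open>As p >= 2, both opening angles are below 3 pi/4. So V does not overlap itself, avoids
  the negative axis far out, and is described by the principal argument.\<close>

lemma angle_bounds: "- pi < \<alpha>" "\<beta> < pi" "- (3 * pi / 2) < p * \<alpha>" "p * \<beta> < 3 * pi / 2"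
proof -
  have p: "2 \<le> real p"
    using p_ge_2 by simp
  have "p * (- \<alpha>) < p * (3 * pi / (2 * real p))" "p * \<beta> < p * (3 * pi / (2 * real p))"
    using \<alpha>_gt \<beta>_less p by (intro mult_strict_left_mono; simp)+
  moreover have "p * (3 * pi / (2 * real p)) = 3 * pi / 2"
    using p by simp
  ultimately show *: "- (3 * pi / 2) < p * \<alpha>" "p * \<beta> < 3 * pi / 2"
    by simp_all
  have "2 * (- \<alpha>) \<le> p * (- \<alpha>)" "2 * \<beta> \<le> p * \<beta>"
    using p \<alpha>_neg \<beta>_pos by (intro mult_right_mono; simp)+
  then show "- pi < \<alpha>" "\<beta> < pi"
    using * pi_gt_zero by linarith+
qed

lemma sector_iff: "X \<in> sector \<alpha> \<beta> \<infinity> \<longleftrightarrow> X \<noteq> 0 \<and> \<alpha> < Arg X \<and> Arg X < \<beta>"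
proof
  assume "X \<in> sector \<alpha> \<beta> \<infinity>"
  then obtain \<theta> where "0 < norm X" "X = norm X * exp (\<i> * \<theta>)" "\<alpha> < \<theta>" "\<theta> < \<beta>"
    unfolding sector_def is_Arg_def by auto
  then show "X \<noteq> 0 \<and> \<alpha> < Arg X \<and> Arg X < \<beta>"
    using Arg_unique[of "norm X" \<theta> X] angle_bounds by auto
next
  assume "X \<noteq> 0 \<and> \<alpha> < Arg X \<and> Arg X < \<beta>"
  then show "X \<in> sector \<alpha> \<beta> \<infinity>"
    unfolding sector_def is_Arg_def using Arg_eq[of X] by auto
qed

text \<open>The value \<open>Arg 0 = 0\<close> lies between \<alpha> and \<beta>, but the conditions
  on the norm decide rightly about the origin in both cases, so it needs no exception.\<close>

lemma V_iff:
  "X \<in> V \<longleftrightarrow> (if 0 < \<mu> then norm X < \<mu> \<or> \<alpha> < Arg X \<and> Arg X < \<beta>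
     else - \<mu> < norm X \<and> \<alpha> < Arg X \<and> Arg X < \<beta>)"
  by (cases "X = 0") (auto simp: V_eq quasi_sector_def sector_iff)

lemma V_large_iff:
  assumes "\<bar>\<mu>\<bar> \<le> norm X" "\<bar>\<mu>\<bar> < norm X \<or> 0 < \<mu>"
  shows "X \<in> V \<longleftrightarrow> \<alpha> < Arg X \<and> Arg X < \<beta>"
  using assms \<mu>_nonzero by (auto simp: V_iff)

lemma rcis_in_V:
  assumes "\<bar>\<mu>\<bar> < r" "\<alpha> < \<phi>" "\<phi> < \<beta>"
  shows "rcis r \<phi> \<in> V" "Arg (rcis r \<phi>) = \<phi>"
proof -
  show "Arg (rcis r \<phi>) = \<phi>"
    using Arg_unique'[of r \<phi>] assms angle_bounds by auto
  then show "rcis r \<phi> \<in> V"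
    using assms by (simp add: V_large_iff)
qed

lemma of_real_in_V:
  assumes "\<bar>\<mu>\<bar> < t"
  shows "of_real t \<in> V"
  using rcis_in_V[of t 0] assms \<alpha>_neg \<beta>_pos by (simp add: rcis_def)

lemma scale_in_V:
  assumes "X \<in> V" "1 \<le> c" "X \<noteq> 0" "0 < \<mu> \<Longrightarrow> \<mu> \<le> norm X"
  shows "of_real c * X \<in> V"
proof -
  have "norm X \<le> norm (of_real c * X)" "Arg (of_real c * X) = Arg X"
    using assms by (simp_all add: norm_mult mult_le_cancel_right1 Arg_times_of_real)
  then show ?thesis
    using assms by (auto simp: V_iff simp del: norm_mult split: if_splits)
qed

lemma infinity_in_V: "infinity_in V \<noteq> bot"
proof
  assume "infinity_in V = bot"
  then obtain R where R: "\<And>X. X \<in> V \<Longrightarrow> R \<le> norm X \<Longrightarrow> False"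
    using eventually_infinity_in[of "\<lambda>_. False" V] by auto
  have "\<bar>\<mu>\<bar> < max R \<bar>\<mu>\<bar> + 1" "R \<le> norm (of_real (max R \<bar>\<mu>\<bar> + 1) :: complex)"
    by auto
  then show False
    using R[OF of_real_in_V] by blast
qed

lemma open_V: "open V"
proof -
  have ap: "X \<notin> \<real>\<^sub>\<le>\<^sub>0" if "X \<noteq> 0" "Arg X < \<beta>" for X
    using that angle_bounds Arg_eq_pi[of X] by (auto simp: complex_nonpos_Reals_iff complex_eq_iff)
  have "sector \<alpha> \<beta> \<infinity> = -\<real>\<^sub>\<le>\<^sub>0 \<inter> Arg -` {\<alpha><..<\<beta>}"
    using ap by (auto simp: sector_iff)
  also have "open \<dots>"
    by (rule continuous_open_preimage[OF continuous_on_Arg]) auto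
  finally have "open (sector \<alpha> \<beta> \<infinity>)" .
  then have "open (sector \<alpha> \<beta> \<infinity> \<union> ball 0 \<mu>)" "open (sector \<alpha> \<beta> \<infinity> \<inter> - cball 0 (- \<mu>))"
    by auto
  moreover have "V = (if 0 < \<mu> then sector \<alpha> \<beta> \<infinity> \<union> ball 0 \<mu> else sector \<alpha> \<beta> \<infinity> \<inter> - cball 0 (- \<mu>))"
    unfolding V_eq quasi_sector_def by auto
  ultimately show ?thesis
    by metis
qed

lemma starlike_V:
  assumes "0 < \<mu>"
  shows "0 \<in> V" "X \<in> V \<Longrightarrow> closed_segment 0 X \<subseteq> V"
proof -
  show "0 \<in> V"
    using assms by (simp add: V_iff)
  assume X: "X \<in> V"
  show "closed_segment 0 X \<subseteq> V"
  proof
    fix Y assume "Y \<in> closed_segment 0 X"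
    then obtain u where u: "0 \<le> u" "u \<le> 1" "Y = of_real u * X"
      by (auto simp: in_segment scaleR_conv_of_real)
    have "norm Y \<le> norm X"
      using u by (simp add: norm_mult mult_left_le_one_le)
    then show "Y \<in> V"
      using X u assms by (cases "u = 0") (auto simp: V_iff Arg_times_of_real)
  qed
qed

text \<open>For \<mu> < 0 the set V is a truncated sector and need not be starlike. The logarithm
  maps it onto this convex half-strip, where connectedness and primitives are at hand.\<close>

definition log_V :: "complex set" where
  "log_V = {w. ln (- \<mu>) < Re w} \<inter> {w. \<alpha> < Im w} \<inter> {w. Im w < \<beta>}"

lemma log_V: "convex log_V" "open log_V"
  unfolding log_V_def
  by (intro convex_Int convex_halfspace_Re_gt convex_halfspace_Im_gt convex_halfspace_Im_lt
      open_Int open_halfspace_Re_gt open_halfspace_Im_gt open_halfspace_Im_lt)+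

lemma V_eq_exp_log_V:
  assumes "\<mu> < 0"
  shows "w \<in> log_V \<Longrightarrow> exp w \<in> V" "X \<in> V \<Longrightarrow> X \<notin> \<real>\<^sub>\<le>\<^sub>0 \<and> Ln X \<in> log_V"
proof -
  assume w: "w \<in> log_V"
  have "exp w = rcis (exp (Re w)) (Im w)"
    by (simp add: exp_eq_polar rcis_def)
  moreover have "\<bar>\<mu>\<bar> < exp (Re w)"
    using w assms ln_less_cancel_iff[of "- \<mu>" "exp (Re w)"] by (simp add: log_V_def)
  ultimately show "exp w \<in> V"
    using rcis_in_V[of "exp (Re w)" "Im w"] w by (simp add: log_V_def)
next
  assume X: "X \<in> V"
  then have "X \<noteq> 0" "- \<mu> < norm X" "\<alpha> < Arg X" "Arg X < \<beta>"
    using assms by (auto simp: V_iff)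
  then show "X \<notin> \<real>\<^sub>\<le>\<^sub>0 \<and> Ln X \<in> log_V"
    using angle_bounds Arg_eq_pi[of X] assms
    by (auto simp: log_V_def Arg_eq_Im_Ln complex_nonpos_Reals_iff complex_eq_iff)
qed

lemma connected_V: "connected V"
proof (cases "0 < \<mu>")
  case True
  then show ?thesis
    using starlike_V by (intro starlike_imp_connected) (auto simp: starlike_def)
next
  case False
  then have "\<mu> < 0"
    using \<mu>_nonzero by auto
  note exp_log = V_eq_exp_log_V[OF this]
  have "V = exp ` log_V"
  proof
    show "V \<subseteq> exp ` log_V"
    proof
      fix X assume "X \<in> V"
      then have "X \<notin> \<real>\<^sub>\<le>\<^sub>0" "Ln X \<in> log_V"
        using exp_log(2) by blast+
      moreover from this have "X \<noteq> 0"
        by auto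
      ultimately show "X \<in> exp ` log_V"
        by (intro image_eqI[of _ _ "Ln X"]) auto
    qed
  qed (use exp_log(1) in auto)
  then show ?thesis
    using log_V by (simp add: connected_continuous_image convex_connected continuous_on_exp)
qed

text \<open>For \<mu> > 0 the set is starlike about 0. For \<mu> < 0 the substitution X = exp w
  leads to a primitive of f(exp w) exp w on a convex set, which is composed with the
  logarithm.\<close>

lemma primitive_on_V:
  assumes f: "f holomorphic_on V"
  obtains H where "\<And>X. X \<in> V \<Longrightarrow> (H has_field_derivative f X) (at X)"
proof (cases "0 < \<mu>")
  case True
  have "\<exists>g. \<forall>x\<in>V. (g has_field_derivative f x) (at x)"
  proof (rule holomorphic_starlike_primitive[of _ _ "{}"])
    show "starlike V"
      using starlike_V True by (auto simp: starlike_def)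
  qed (use f open_V in \<open>auto intro: holomorphic_on_imp_continuous_on holomorphic_on_imp_differentiable_at\<close>)
  then show ?thesis
    using that by blast
next
  case False
  then have \<mu>: "\<mu> < 0"
    using \<mu>_nonzero by auto
  have "(\<lambda>w. f (exp w) * exp w) holomorphic_on log_V"
    using V_eq_exp_log_V[OF \<mu>]
    by (intro holomorphic_intros holomorphic_on_compose_gen[OF _ f, unfolded o_def]) auto
  then obtain K where K: "\<And>w. w \<in> log_V \<Longrightarrow> (K has_field_derivative f (exp w) * exp w) (at w within log_V)"
    using holomorphic_convex_primitive'[OF log_V] by blast
  show ?thesis
  proof (rule that)
    fix X assume "X \<in> V"
    then have X: "X \<notin> \<real>\<^sub>\<le>\<^sub>0" "Ln X \<in> log_V"
      using V_eq_exp_log_V[OF \<mu>] by auto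
    then have "X \<noteq> 0"
      by auto
    have "(K has_field_derivative f X * X) (at (Ln X))"
      using K[OF X(2)] \<open>X \<noteq> 0\<close> by (simp add: at_within_open[OF X(2) log_V(2)])
    from DERIV_chain2[OF this has_field_derivative_Ln[OF X(1)]]
    show "((\<lambda>X. K (Ln X)) has_field_derivative f X) (at X)"
      using \<open>X \<noteq> 0\<close> by (simp add: mult.assoc)
  qed
qed

end

section \<open>Decay at infinity of primitives of exp(-t^p) f(t)\<close>

context quasi_sector_equation begin

text \<open>Mean value inequality along the arc |t| = r from the positive axis to the angle \<phi>:
  there Re t^p is at least r^p cos \<theta>, and the arc is at most pi r long. This carries the
  limit 0 on the positive axis over to nearby directions, where the paths below end.\<close>

lemma primitive_near_real_axis:
  fixes r \<phi> \<theta> :: real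
  assumes H: "\<And>t. t \<in> V \<Longrightarrow> R \<le> norm t \<Longrightarrow> (H has_field_derivative exp (- (t ^ p)) * f t) (at t)"
    and f: "\<And>t. t \<in> V \<Longrightarrow> R \<le> norm t \<Longrightarrow> norm (f t) \<le> C"
    and r: "\<bar>\<mu>\<bar> < r" "R \<le> r" and \<phi>: "\<alpha> < \<phi>" "\<phi> < \<beta>"
    and \<theta>: "\<bar>p * \<phi>\<bar> \<le> \<theta>" "\<theta> < pi / 2"
  shows "norm (H (rcis r \<phi>)) \<le> norm (H (of_real r)) + pi * C * (r * exp (- (r ^ p) * cos \<theta>))"
proof -
  let ?h = "\<lambda>w. H (of_real r * exp (\<i> * w))"
  let ?h' = "\<lambda>w. let t = of_real r * exp (\<i> * w) in exp (- (t ^ p)) * f t * (of_real r * (exp (\<i> * w) * \<i>))"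
  let ?B = "exp (- (r ^ p) * cos \<theta>) * C * r"
  have "C \<ge> 0"
    using order_trans[OF norm_ge_zero f[OF of_real_in_V[OF r(1)]]] r by simp
  have rcis: "of_real r * exp (\<i> * of_real s) = rcis r s" for s
    by (simp add: rcis_def cis_conv_exp)
  have "norm (?h (of_real \<phi>) - ?h 0) \<le> ?B * norm (of_real \<phi> - 0 :: complex)"
  proof (rule field_differentiable_bound[OF convex_closed_segment])
    fix w assume "w \<in> closed_segment 0 (of_real \<phi> :: complex)"
    then obtain u where u: "0 \<le> u" "u \<le> 1" "w = of_real (u * \<phi>)"
      by (auto simp: in_segment scaleR_conv_of_real)
    have "\<bar>u * \<phi>\<bar> \<le> \<bar>\<phi>\<bar>"
      using u by (simp add: abs_mult mult_left_le_one_le)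
    then have s: "\<alpha> < u * \<phi>" "u * \<phi> < \<beta>" "\<bar>p * (u * \<phi>)\<bar> \<le> \<theta>"
    proof -
      have "u * \<phi> \<le> max 0 \<phi>" "min 0 \<phi> \<le> u * \<phi>"
        using u mult_left_le_one_le[of \<phi> u] mult_left_le_one_le[of "- \<phi>" u]
        by (cases "0 \<le> \<phi>"; simp add: mult_nonneg_nonpos)+
      then show "\<alpha> < u * \<phi>" "u * \<phi> < \<beta>"
        using \<phi> \<alpha>_neg \<beta>_pos by auto
      have "\<bar>p * (u * \<phi>)\<bar> \<le> \<bar>p * \<phi>\<bar>"
        using u by (auto simp: abs_mult intro!: mult_left_mono mult_left_le_one_le)
      then show "\<bar>p * (u * \<phi>)\<bar> \<le> \<theta>"
        using \<theta> by simp
    qed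
    let ?t = "of_real r * exp (\<i> * w)"
    have t: "?t = rcis r (u * \<phi>)"
      using rcis[of "u * \<phi>"] u by simp
    have tV: "?t \<in> V"
      unfolding t using rcis_in_V r s by blast
    show "(?h has_field_derivative ?h' w) (at w within closed_segment 0 (of_real \<phi>))"
      unfolding Let_def
      by (rule has_field_derivative_at_within, rule DERIV_chain2[of H _ "\<lambda>w. of_real r * exp (\<i> * w)", OF H[OF tV]])
         (use t r in \<open>auto intro!: derivative_eq_intros\<close>)
    have "norm (f ?t) \<le> C"
      using f[OF tV] t r by simp
    moreover have "norm (exp (- (?t ^ p))) \<le> exp (- (r ^ p) * cos \<theta>)"
    proof -
      have "?t ^ p = rcis (r ^ p) (p * (u * \<phi>))"
        unfolding t by (simp only: DeMoivre2)
      moreover have "cos \<theta> \<le> cos (p * (u * \<phi>))"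
        using cos_monotone_0_pi_le[of "\<bar>p * (u * \<phi>)\<bar>" \<theta>] s(3) \<theta> by simp
      ultimately show ?thesis
        using r by (simp add: mult_left_mono)
    qed
    ultimately have "norm (exp (- (?t ^ p))) * norm (f ?t) * r \<le> ?B"
      using r \<open>C \<ge> 0\<close> by (intro mult_right_mono mult_mono) auto
    moreover have "norm (exp (\<i> * w)) = 1"
      using u by (simp flip: of_real_mult)
    ultimately show "norm (?h' w) \<le> ?B"
      using r unfolding Let_def norm_mult by simp
  qed auto
  also have "\<dots> \<le> ?B * pi"
    using r \<open>C \<ge> 0\<close> \<phi> angle_bounds by (intro mult_left_mono) auto
  finally have "norm (H (rcis r \<phi>) - H (of_real r)) \<le> ?B * pi"
    using rcis[of \<phi>] by simp
  then show ?thesis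
    using norm_triangle_ineq2[of "H (rcis r \<phi>)" "H (of_real r)"] by (simp add: mult_ac)
qed

text \<open>The path \<open>t(\<tau>) = X (1 + \<tau> e\<^sup>i\<^sup>\<omega>)\<^sup>1\<^sup>/\<^sup>p\<close> maps under \<open>t \<mapsto> t\<^sup>p\<close> to the ray from \<open>X\<^sup>p\<close> in the direction \<open>\<theta>\<close>.
  Because \<open>\<bar>\<omega>\<bar> < \<pi>\<close>, the principal branch is the right one even if \<open>X\<^sup>p\<close> lies on another sheet.\<close>

lemma decay_along_ray:
  assumes H: "\<And>t. t \<in> V \<Longrightarrow> R \<le> norm t \<Longrightarrow> (H has_field_derivative exp (- (t ^ p)) * f t) (at t)"
    and "C \<ge> 0" and f: "\<And>t. t \<in> V \<Longrightarrow> R \<le> norm t \<Longrightarrow> norm (f t) \<le> C / norm t ^ M"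
    and lim: "((\<lambda>t. H (of_real t)) \<longlongrightarrow> 0) at_top"
    and \<theta>: "\<bar>\<theta>\<bar> < pi / 2" "\<alpha> < \<theta> / p" "\<theta> / p < \<beta>" and \<omega>0: "0 \<le> \<omega>0" "\<omega>0 < pi"
  shows "\<exists>C' R'. \<forall>X\<in>V. R' \<le> norm X \<and> \<bar>\<theta> - p * Arg X\<bar> \<le> \<omega>0 \<longrightarrow>
    norm (exp (X ^ p) * H X) \<le> C' / norm X ^ M"
proof -
  define m where "m = sqrt ((1 + cos \<omega>0) / 2)"
  have m: "0 < m" "m \<le> 1"
    unfolding m_def using sqrt_half_one_plus_cos[OF \<omega>0] by auto
  have p: "p > 0"
    using p_ge_2 by auto
  have cos: "0 < cos \<theta>"
    using \<theta> by (intro cos_gt_zero_pi) auto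
  \<comment> \<open>Since |t| >= m |X| on the whole path, |X| >= \<open>R1\<close> keeps the path
    beyond the radii 1, \<open>R\<close> and |\<mu>|, where the assumptions on \<open>H\<close> and
    \<open>f\<close> apply.\<close>
  define R1 where "R1 = (max 1 (max R (\<bar>\<mu>\<bar> + 1))) / m"
  define C1 where "C1 = C / (p * cos \<theta> * m ^ (M + p - 1))"
  show ?thesis
  proof (rule exI[of _ C1], rule exI[of _ R1], intro ballI impI)
    fix X assume X: "X \<in> V" and "R1 \<le> norm X \<and> \<bar>\<theta> - p * Arg X\<bar> \<le> \<omega>0"
    then have RX: "1 \<le> m * norm X" "R \<le> m * norm X" "\<bar>\<mu>\<bar> < m * norm X"
      and le: "\<bar>\<theta> - p * Arg X\<bar> \<le> \<omega>0"
      using m by (auto simp: R1_def field_simps)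
    have "m * norm X \<le> norm X"
      using m by (simp add: mult_left_le_one_le)
    then have X1: "1 \<le> norm X" "\<bar>\<mu>\<bar> < norm X" "R \<le> norm X" "X \<noteq> 0"
      using RX by auto
    define \<phi> where "\<phi> = Arg X"
    have \<phi>: "\<alpha> < \<phi>" "\<phi> < \<beta>"
      using X X1 V_large_iff[of X] by (auto simp: \<phi>_def)
    have X_rcis: "X = rcis (norm X) \<phi>"
      by (simp add: \<phi>_def rcis_cmod_Arg)
    define \<omega> where "\<omega> = \<theta> - p * \<phi>"
    have \<omega>: "\<bar>\<omega>\<bar> \<le> \<omega>0" "\<bar>\<omega>\<bar> < pi"
      using le \<omega>0 by (auto simp: \<omega>_def \<phi>_def)
    define z where "z = (\<lambda>\<tau>. 1 + of_real \<tau> * cis \<omega>)"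
    define q where "q = (\<lambda>\<tau>. exp (Ln (z \<tau>) / of_nat p))"
    define t where "t = (\<lambda>\<tau>. X * q \<tau>)"
    have z: "z \<tau> \<notin> \<real>\<^sub>\<le>\<^sub>0" "z \<tau> \<noteq> 0" "m * (1 + \<tau>) \<le> norm (z \<tau>)" "Arg (z \<tau>) \<in> closed_segment 0 \<omega>"
      if "0 \<le> \<tau>" for \<tau>
      using one_plus_ray_notin_nonpos_Reals[OF \<omega>(2) that] norm_one_plus_ray[OF \<omega>(1) \<omega>0(2) that]
        Arg_one_plus_ray[OF \<omega>(2) that] by (auto simp: z_def m_def)
    have z_m: "m \<le> norm (z \<tau>)" if "0 \<le> \<tau>" for \<tau>
      using z(3)[OF that] mult_left_mono[of 1 "1 + \<tau>" m] that m by linarith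
    have q_pow: "q \<tau> ^ p = z \<tau>" if "0 \<le> \<tau>" for \<tau>
      using z[OF that] p by (simp add: q_def flip: exp_of_nat_mult)
    \<comment> \<open>The natural bound is the p-th root of \<open>m\<close>; as m <= 1,
      \<open>m\<close> itself is a weaker bound that avoids the root.\<close>
    have q_m: "m \<le> norm (q \<tau>)" if "0 \<le> \<tau>" for \<tau>
    proof (rule ccontr)
      assume *: "\<not> m \<le> norm (q \<tau>)"
      then have "norm (q \<tau>) ^ p \<le> norm (q \<tau>) ^ 1"
        using m p by (intro power_decreasing) auto
      then show False
        using * z_m[OF that] q_pow[OF that] by (simp flip: norm_power)
    qed
    \<comment> \<open>Because X^p e^(i \<omega>) = |X|^p e^(i \<theta>), the power t^p moves in the
      fixed direction \<theta> with speed |X|^p.\<close>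
    have t_pow: "t \<tau> ^ p = X ^ p + of_real (\<tau> * norm X ^ p) * cis \<theta>" if "0 \<le> \<tau>" for \<tau>
    proof -
      have "X ^ p * cis \<omega> = of_real (norm X ^ p) * cis \<theta>"
        by (subst X_rcis, simp only: DeMoivre2) (simp add: rcis_def cis_mult \<omega>_def)
      then show ?thesis
        by (simp add: t_def power_mult_distrib q_pow[OF that] z_def algebra_simps)
    qed
    define \<psi> where "\<psi> = (\<lambda>\<tau>. \<phi> + Arg (z \<tau>) / p)"
    have t_rcis: "t \<tau> = rcis (norm (t \<tau>)) (\<psi> \<tau>)" if "0 \<le> \<tau>" for \<tau>
    proof -
      have "q \<tau> = rcis (norm (q \<tau>)) (Arg (z \<tau>) / p)"
        using z[OF that] by (simp add: q_def exp_eq_polar[of "Ln _ / _"] rcis_def Arg_eq_Im_Ln norm_mult)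
      then have "t \<tau> = rcis (norm X) \<phi> * rcis (norm (q \<tau>)) (Arg (z \<tau>) / p)"
        unfolding t_def using X_rcis by metis
      then have "t \<tau> = rcis (norm X * norm (q \<tau>)) (\<psi> \<tau>)"
        by (simp only: rcis_mult \<psi>_def)
      moreover have "norm (t \<tau>) = norm X * norm (q \<tau>)"
        by (simp add: t_def norm_mult)
      ultimately show ?thesis
        by metis
    qed
    \<comment> \<open>The argument of t runs between \<open>\<phi>\<close> and
      \<open>\<theta> / p\<close>. Both lie in the opening of V, so the path cannot leave V
      sideways.\<close>
    have \<psi>: "\<alpha> < \<psi> \<tau>" "\<psi> \<tau> < \<beta>" if "0 \<le> \<tau>" for \<tau>
    proof -
      have "\<phi> + \<omega> / p = \<theta> / p"
        using p by (simp add: \<omega>_def field_simps)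
      moreover have "min 0 (\<omega> / p) \<le> Arg (z \<tau>) / p \<and> Arg (z \<tau>) / p \<le> max 0 (\<omega> / p)"
        using z(4)[OF that] divide_right_mono[of "Arg (z \<tau>)" \<omega> "real p"]
          divide_right_mono[of \<omega> "Arg (z \<tau>)" "real p"]
        by (auto simp: closed_segment_eq_real_ivl min_le_iff_disj le_max_iff_disj zero_le_divide_iff
            divide_le_0_iff split: if_splits)
      ultimately have "min \<phi> (\<theta> / p) \<le> \<psi> \<tau>" "\<psi> \<tau> \<le> max \<phi> (\<theta> / p)"
        unfolding \<psi>_def by linarith+
      then show "\<alpha> < \<psi> \<tau>" "\<psi> \<tau> < \<beta>"
        using \<phi> \<theta> by auto
    qed
    have norm_t: "m * norm X \<le> norm (t \<tau>)" if "0 \<le> \<tau>" for \<tau>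
      using q_m[OF that] mult_right_mono[of m "norm (q \<tau>)" "norm X"] by (simp add: t_def norm_mult mult.commute)
    have tV: "t \<tau> \<in> V" if "0 \<le> \<tau>" for \<tau>
      by (subst t_rcis[OF that], rule rcis_in_V)
         (use norm_t[OF that] RX \<psi>[OF that] in auto)
    \<comment> \<open>In \<open>D\<close> the first factor bounds \<open>f\<close> on the path and
      the second one |t'| = |X| / (p |q|^(p-1)); \<open>c\<close> is the rate at which Re t^p grows.
      Together they majorise the derivative of \<open>H\<close> along the path.\<close>
    define D where "D = C / (m * norm X) ^ M * (norm X / (p * m ^ (p - 1)))"
    define c where "c = norm X ^ p * cos \<theta>"
    have "D \<ge> 0" "c > 0"
      using \<open>C \<ge> 0\<close> m X1 cos by (auto simp: D_def c_def)
    define w where "w = (\<lambda>\<tau>. H (t \<tau>))"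
    define w' where "w' = (\<lambda>\<tau>. (X * (q \<tau> * (cis \<omega> / (z \<tau> * of_nat p)))) * (exp (- (t \<tau> ^ p)) * f (t \<tau>)))"
    have H_t: "(H has_field_derivative exp (- (t \<tau> ^ p)) * f (t \<tau>)) (at (t \<tau>))" if "0 \<le> \<tau>" for \<tau>
      by (rule H[OF tV[OF that]]) (use norm_t[OF that] RX in linarith)
    have w_deriv: "(w has_vector_derivative w' \<tau>) (at \<tau>)" if "0 < \<tau>" for \<tau>
    proof -
      have \<tau>: "0 \<le> \<tau>" using that by simp
      have "((\<lambda>s. 1 + s * cis \<omega>) has_field_derivative cis \<omega>) (at (of_real \<tau>))"
        by (auto intro!: derivative_eq_intros)
      then have "((\<lambda>s. X * exp (Ln (1 + s * cis \<omega>) / of_nat p)) has_field_derivative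
          X * (q \<tau> * (cis \<omega> / (z \<tau> * of_nat p)))) (at (of_real \<tau>))"
        using z[OF \<tau>] p unfolding q_def z_def
        by (auto intro!: derivative_eq_intros simp: divide_simps)
      then have "(t has_vector_derivative X * (q \<tau> * (cis \<omega> / (z \<tau> * of_nat p)))) (at \<tau>)"
        unfolding t_def q_def z_def by (rule has_vector_derivative_real_field)
      from field_vector_diff_chain_at[OF this H_t[OF \<tau>]]
      show ?thesis
        by (simp add: w_def w'_def o_def)
    qed
    have w_bound: "norm (w' \<tau>) \<le> D * exp (- Re (X ^ p) - c * \<tau>)" if "0 < \<tau>" for \<tau>
    proof -
      have \<tau>: "0 \<le> \<tau>" using that by simp
      have "norm (f (t \<tau>)) \<le> C / norm (t \<tau>) ^ M"
        using norm_t[OF \<tau>] RX by (intro f[OF tV[OF \<tau>]]) linarith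
      also have "\<dots> \<le> C / (m * norm X) ^ M"
        using norm_t[OF \<tau>] RX \<open>C \<ge> 0\<close> m X1
        by (intro divide_left_mono power_mono) (auto intro!: mult_pos_pos zero_less_power)
      finally have f1: "norm (f (t \<tau>)) \<le> C / (m * norm X) ^ M" .
      have "norm (z \<tau>) = norm (q \<tau>) * norm (q \<tau>) ^ (p - 1)"
        unfolding q_pow[OF \<tau>, symmetric] norm_power
        using power_minus_mult[OF p, of "norm (q \<tau>)"] by (simp add: mult.commute)
      moreover have "m ^ (p - 1) \<le> norm (q \<tau>) ^ (p - 1)" "0 < norm (q \<tau>)"
        using q_m[OF \<tau>] m by (auto intro: power_mono)
      ultimately have "norm X * (norm (q \<tau>) / (norm (z \<tau>) * p)) \<le> norm X / (p * m ^ (p - 1))"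
        using p m X1 by (simp add: divide_simps mult_ac)
      then have q1: "norm (X * (q \<tau> * (cis \<omega> / (z \<tau> * of_nat p)))) \<le> norm X / (p * m ^ (p - 1))"
        by (simp add: norm_mult norm_divide)
      have e: "norm (exp (- (t \<tau> ^ p))) = exp (- Re (X ^ p) - c * \<tau>)"
        by (simp add: t_pow[OF \<tau>] c_def algebra_simps)
      have "norm (w' \<tau>) \<le> (norm X / (p * m ^ (p - 1))) * (exp (- Re (X ^ p) - c * \<tau>) * (C / (m * norm X) ^ M))"
        unfolding w'_def norm_mult[of "X * _"] norm_mult[of "exp _"] e
        using f1 q1 m by (intro mult_mono) auto
      then show ?thesis
        by (simp add: D_def mult_ac)
    qed
    have t_cont: "continuous_on {0..T} t" for T
      unfolding t_def q_def
      by (intro continuous_intros) (use z(1) p in \<open>auto simp: z_def intro!: continuous_intros\<close>)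
    have w_cont: "continuous_on {0..T} w" for T
      unfolding w_def
      by (rule continuous_on_compose2[OF _ t_cont, of "t ` {0..T}"])
         (auto intro!: continuous_at_imp_continuous_on DERIV_isCont[OF H_t])
    have w_diff: "norm (w T - w 0) \<le> D / c * exp (- Re (X ^ p))" if "0 < T" for T
    proof -
      have "norm (w T - w 0) \<le> - (D / c) * exp (- Re (X ^ p) - c * T) - (- (D / c) * exp (- Re (X ^ p) - c * 0))"
        using that w_cont
      proof (rule differentiable_bound_general)
        show "norm (w' \<tau>) \<le> D * exp (- Re (X ^ p) - c * \<tau>)" if "0 < \<tau>" for \<tau>
          by (rule w_bound[OF that])
        show "((\<lambda>\<tau>. - (D / c) * exp (- Re (X ^ p) - c * \<tau>)) has_vector_derivative
            D * exp (- Re (X ^ p) - c * \<tau>)) (at \<tau>)" for \<tau>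
          unfolding has_real_derivative_iff_has_vector_derivative[symmetric]
          using \<open>c > 0\<close> by (auto intro!: derivative_eq_intros)
      qed (use \<open>c > 0\<close> w_deriv in \<open>auto intro!: continuous_intros\<close>)
      also have "\<dots> \<le> D / c * exp (- Re (X ^ p))"
        using \<open>D \<ge> 0\<close> \<open>c > 0\<close> by simp
      finally show ?thesis .
    qed
    \<comment> \<open>For \<tau> > 0 the points z and z/\<tau> = 1/\<tau> + e^(i \<omega>) have the
      same argument; the latter converge to e^(i \<omega>), where \<open>Arg\<close> is continuous
      because |\<omega>| < pi.\<close>
    have p_\<psi>_lim: "((\<lambda>\<tau>. p * \<psi> \<tau>) \<longlongrightarrow> \<theta>) at_top"
    proof -
      have "((\<lambda>\<tau>. of_real (1 / \<tau>) + cis \<omega>) \<longlongrightarrow> of_real 0 + cis \<omega>) at_top"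
        by (intro tendsto_intros) real_asymp
      moreover have "cis \<omega> \<notin> \<real>\<^sub>\<le>\<^sub>0"
      proof
        assume "cis \<omega> \<in> \<real>\<^sub>\<le>\<^sub>0"
        then have "cos \<omega> \<le> 0" "sin \<omega> = 0"
          by (auto simp: complex_nonpos_Reals_iff)
        moreover have "- pi < \<omega>" "\<omega> < pi"
          using \<omega>(2) by linarith+
        ultimately have "cos \<omega> \<le> 0" "\<omega> = 0"
          using sin_eq_0_pi by blast+
        then show False
          using cos_zero by (metis not_one_le_zero)
      qed
      ultimately have "((\<lambda>\<tau>. Arg (of_real (1 / \<tau>) + cis \<omega>)) \<longlongrightarrow> Arg (cis \<omega>)) at_top"
        by (intro tendsto_Arg) auto
      moreover have "Arg (cis \<omega>) = \<omega>"
        using \<omega>(2) by (intro Arg_cis) auto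
      moreover have "\<forall>\<^sub>F \<tau> in at_top. Arg (of_real (1 / \<tau>) + cis \<omega>) = Arg (z \<tau>)"
      proof (rule eventually_mono[OF eventually_gt_at_top[of 0]])
        fix \<tau> :: real assume "0 < \<tau>"
        then have "z \<tau> = of_real \<tau> * (of_real (1 / \<tau>) + cis \<omega>)"
          by (simp add: z_def field_simps)
        then show "Arg (of_real (1 / \<tau>) + cis \<omega>) = Arg (z \<tau>)"
          using \<open>0 < \<tau>\<close> by (simp only: Arg_times_of_real if_True)
      qed
      ultimately have "((\<lambda>\<tau>. Arg (z \<tau>)) \<longlongrightarrow> \<omega>) at_top"
        using Lim_transform_eventually by fastforce
      then have "((\<lambda>\<tau>. p * \<phi> + Arg (z \<tau>)) \<longlongrightarrow> p * \<phi> + \<omega>) at_top"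
        by (intro tendsto_intros)
      then show ?thesis
        using p by (simp add: \<psi>_def \<omega>_def distrib_left)
    qed
    have norm_t_lim: "filterlim (\<lambda>\<tau>. norm (t \<tau>)) at_top at_top"
      unfolding filterlim_at_top_gt[of _ _ 0]
    proof (intro allI impI)
      fix B :: real assume "0 < B"
      show "\<forall>\<^sub>F \<tau> in at_top. B \<le> norm (t \<tau>)"
      proof (rule eventually_mono[OF eventually_ge_at_top[of "B ^ p / m"]])
        fix \<tau> assume \<tau>: "B ^ p / m \<le> \<tau>"
        moreover have "0 \<le> B ^ p / m"
          using \<open>0 < B\<close> m by simp
        ultimately have "0 \<le> \<tau>"
          by simp
        have "B ^ p \<le> m * \<tau>"
          using \<tau> m by (simp add: field_simps)
        also have "\<dots> \<le> norm (z \<tau>)"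
          using z(3)[OF \<open>0 \<le> \<tau>\<close>] m by (simp add: algebra_simps)
        also have "\<dots> \<le> norm X ^ p * norm (z \<tau>)"
          using X1 one_le_power[of "norm X" p] by (simp add: mult_le_cancel_right1)
        also have "\<dots> = norm (t \<tau>) ^ p"
          by (simp add: t_def norm_mult power_mult_distrib flip: q_pow[OF \<open>0 \<le> \<tau>\<close>] norm_power)
        finally show "B \<le> norm (t \<tau>)"
          by (rule power_le_imp_le_base[of _ "p - 1", unfolded Suc_diff_1[OF p]]) auto
      qed
    qed
    have w_lim: "(w \<longlongrightarrow> 0) at_top"
    proof -
      \<comment> \<open>The angle of t^p only tends to \<theta>, so the arc estimate is used in a
        slightly wider sector; the midpoint of |\<theta>| and pi/2 leaves room on both
        sides.\<close>
      define \<theta>' where "\<theta>' = (\<bar>\<theta>\<bar> + pi / 2) / 2"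
      have \<theta>': "\<bar>\<theta>\<bar> < \<theta>'" "\<theta>' < pi / 2"
        using \<theta>(1) by (auto simp: \<theta>'_def)
      then have cos': "0 < cos \<theta>'"
        by (intro cos_gt_zero_pi) auto
      define b where "b = (\<lambda>r::real. norm (H (of_real r)) + pi * C * (r * exp (- (r ^ p) * cos \<theta>')))"
      have "((\<lambda>r::real. r * exp (- (r ^ p) * cos \<theta>')) \<longlongrightarrow> 0) at_top"
      proof (rule Lim_null_comparison)
        show "((\<lambda>r::real. r * exp (- r * cos \<theta>')) \<longlongrightarrow> 0) at_top"
          using cos' by real_asymp
        show "\<forall>\<^sub>F r::real in at_top. norm (r * exp (- (r ^ p) * cos \<theta>')) \<le> r * exp (- r * cos \<theta>')"
        proof (rule eventually_mono[OF eventually_ge_at_top[of 1]])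
          fix r :: real assume r: "1 \<le> r"
          have "r \<le> r ^ p"
            using power_increasing[of 1 p r] r p by simp
          then show "norm (r * exp (- (r ^ p) * cos \<theta>')) \<le> r * exp (- r * cos \<theta>')"
            using r cos' by (simp add: abs_mult mult_right_mono)
        qed
      qed
      then have "(b \<longlongrightarrow> 0) at_top"
        unfolding b_def by (intro tendsto_add_zero tendsto_mult_right_zero tendsto_norm_zero lim)
      then have "((\<lambda>\<tau>. b (norm (t \<tau>))) \<longlongrightarrow> 0) at_top"
        by (rule filterlim_compose[OF _ norm_t_lim])
      moreover have "\<forall>\<^sub>F \<tau> in at_top. norm (w \<tau>) \<le> b (norm (t \<tau>))"
      proof -
        have "\<forall>\<^sub>F \<tau> in at_top. dist (p * \<psi> \<tau>) \<theta> < \<theta>' - \<bar>\<theta>\<bar>"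
          using tendstoD[OF p_\<psi>_lim] \<theta>' by simp
        then show ?thesis
          using eventually_ge_at_top[of 0]
        proof eventually_elim
          case (elim \<tau>)
          have "\<bar>p * \<psi> \<tau>\<bar> \<le> \<theta>'"
            using elim(1) by (simp add: dist_real_def)
          moreover have "norm (f s) \<le> C" if "s \<in> V" "max 1 R \<le> norm s" for s
          proof -
            have "norm (f s) \<le> C / norm s ^ M"
              using f that by simp
            also have "\<dots> \<le> C"
              using that \<open>C \<ge> 0\<close> one_le_power[of "norm s" M] by (auto simp: divide_le_eq mult_le_cancel_left1)
            finally show ?thesis .
          qed
          moreover have "\<bar>\<mu>\<bar> < norm (t \<tau>)" "max 1 R \<le> norm (t \<tau>)"
            using norm_t[OF elim(2)] RX by auto
          ultimately have "norm (H (rcis (norm (t \<tau>)) (\<psi> \<tau>))) \<le> b (norm (t \<tau>))"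
            unfolding b_def
            using H \<psi>[OF elim(2)] \<theta>'
            by (intro primitive_near_real_axis[where R = "max 1 R" and H = H and f = f]) auto
          then show ?case
            using t_rcis[OF elim(2)] by (simp add: w_def)
        qed
      qed
      ultimately show ?thesis
        by (rule Lim_null_comparison[rotated])
    qed
    have w0: "w 0 = H X"
      by (simp add: w_def t_def q_def z_def)
    \<comment> \<open>With T tending to infinity, \<open>w_diff\<close> becomes a bound for
      \<open>H X\<close> itself, and its factor exp(-Re X^p) cancels |exp(X^p)| exactly.\<close>
    have "((\<lambda>T. norm (w T - w 0)) \<longlongrightarrow> norm (0 - w 0)) at_top"
      by (intro tendsto_intros w_lim)
    then have "norm (0 - w 0) \<le> D / c * exp (- Re (X ^ p))"
      by (rule tendsto_upperbound)
         (use eventually_mono[OF eventually_gt_at_top[of 0] w_diff] in auto)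
    then have "norm (exp (X ^ p) * H X) \<le> exp (Re (X ^ p)) * (D / c * exp (- Re (X ^ p)))"
      unfolding norm_mult by (intro mult_mono) (auto simp: w0)
    also have "\<dots> = D / c"
      by (simp add: exp_minus)
    also have "\<dots> = C1 / norm X ^ M * (1 / norm X ^ (p - 1))"
    proof -
      have "norm X ^ p = norm X * norm X ^ (p - 1)" "M + p - 1 = M + (p - 1)"
        using p power_minus_mult[OF p, of "norm X"] by (simp_all add: mult.commute)
      then show ?thesis
        using X1 m by (simp add: D_def c_def C1_def power_add power_mult_distrib divide_simps)
    qed
    also have "\<dots> \<le> C1 / norm X ^ M * 1"
    proof (rule mult_left_mono)
      show "0 \<le> C1 / norm X ^ M"
        using m cos \<open>C \<ge> 0\<close> by (simp add: C1_def)
      show "1 / norm X ^ (p - 1) \<le> 1"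
        using one_le_power[OF X1(1), of "p - 1"] by (simp add: divide_le_eq)
    qed
    finally show "norm (exp (X ^ p) * H X) \<le> C1 / norm X ^ M"
      by (simp only: mult_1_right)
  qed
qed

text \<open>The angle p Arg X may range over an interval almost 3 pi wide, so a single direction
  need not stay within pi of it. Uniform constants ask for finitely many directions; two suffice,
  one for Arg X >= 0 and one for Arg X < 0.\<close>

lemma primitive_decay:
  assumes H: "\<And>t. t \<in> V \<Longrightarrow> R \<le> norm t \<Longrightarrow> (H has_field_derivative exp (- (t ^ p)) * f t) (at t)"
    and "C \<ge> 0" and f: "\<And>t. t \<in> V \<Longrightarrow> R \<le> norm t \<Longrightarrow> norm (f t) \<le> C / norm t ^ M"
    and lim: "((\<lambda>t. H (of_real t)) \<longlongrightarrow> 0) at_top"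
  shows "\<exists>C' R'. \<forall>X\<in>V. R' \<le> norm X \<longrightarrow> norm (exp (X ^ p) * H X) \<le> C' / norm X ^ M"
proof -
  have p: "0 < real p"
    using p_ge_2 by auto
  have p\<beta>: "0 < p * \<beta>" and p\<alpha>: "p * \<alpha> < 0"
    using p \<alpha>_neg \<beta>_pos by (auto simp: mult_pos_neg)
  \<comment> \<open>Room for both directions exists because p \<beta> and -p \<alpha> are below 3
    pi/2. For \<theta>1: the bound pi/2 gives decay, the bound p \<beta> keeps the end of the path
    in V, and \<theta>1 > p \<beta> - pi keeps the angle to X^p below pi up to the edge of
    V.\<close>
  have "max 0 (p * \<beta> - pi) < min (pi / 2) (p * \<beta>)" "max 0 (p * (- \<alpha>) - pi) < min (pi / 2) (p * (- \<alpha>))"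
    unfolding max_less_iff_conj min_less_iff_conj
    using p\<alpha> p\<beta> angle_bounds(3,4) pi_gt_zero by (intro conjI; linarith)+
  then obtain \<theta>1 \<theta>2' where "max 0 (p * \<beta> - pi) < \<theta>1" "\<theta>1 < min (pi / 2) (p * \<beta>)"
      "max 0 (p * (- \<alpha>) - pi) < \<theta>2'" "\<theta>2' < min (pi / 2) (p * (- \<alpha>))"
    using dense by metis
  then obtain \<theta>2 where \<theta>1: "0 < \<theta>1" "\<theta>1 < pi / 2" "\<theta>1 < p * \<beta>" "p * \<beta> - pi < \<theta>1"
    and \<theta>2: "\<theta>2 < 0" "- (pi / 2) < \<theta>2" "p * \<alpha> < \<theta>2" "\<theta>2 < p * \<alpha> + pi"
    by (auto intro!: that[of "- \<theta>2'"])
  have div: "\<alpha> < \<theta>1 / p" "\<theta>1 / p < \<beta>" "\<alpha> < \<theta>2 / p" "\<theta>2 / p < \<beta>"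
    using \<theta>1 \<theta>2 p \<alpha>_neg \<beta>_pos p\<alpha> p\<beta> by (simp_all add: pos_less_divide_eq pos_divide_less_eq mult.commute)
  define \<omega>1 where "\<omega>1 = max \<theta>1 (p * \<beta> - \<theta>1)"
  define \<omega>2 where "\<omega>2 = max (- \<theta>2) (\<theta>2 - p * \<alpha>)"
  have abs: "\<bar>\<theta>1\<bar> < pi / 2" "\<bar>\<theta>2\<bar> < pi / 2"
    using \<theta>1 \<theta>2 by auto
  have \<omega>: "0 \<le> \<omega>1" "\<omega>1 < pi" "0 \<le> \<omega>2" "\<omega>2 < pi"
    using \<theta>1 \<theta>2 by (auto simp: \<omega>1_def \<omega>2_def)
  obtain C1 R1 where 1: "\<And>X. X \<in> V \<Longrightarrow> R1 \<le> norm X \<Longrightarrow> \<bar>\<theta>1 - p * Arg X\<bar> \<le> \<omega>1 \<Longrightarrow>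
      norm (exp (X ^ p) * H X) \<le> C1 / norm X ^ M"
    using decay_along_ray[OF H assms(2) f lim abs(1) div(1,2) \<omega>(1,2)] by blast
  obtain C2 R2 where 2: "\<And>X. X \<in> V \<Longrightarrow> R2 \<le> norm X \<Longrightarrow> \<bar>\<theta>2 - p * Arg X\<bar> \<le> \<omega>2 \<Longrightarrow>
      norm (exp (X ^ p) * H X) \<le> C2 / norm X ^ M"
    using decay_along_ray[OF H assms(2) f lim abs(2) div(3,4) \<omega>(3,4)] by blast
  show ?thesis
  proof (intro exI ballI impI)
    fix X assume X: "X \<in> V" "max (max R1 R2) (\<bar>\<mu>\<bar> + 1) \<le> norm X"
    then have "\<alpha> < Arg X" "Arg X < \<beta>"
      using V_large_iff[of X] by auto
    then have A: "p * \<alpha> < p * Arg X" "p * Arg X < p * \<beta>"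
      using p by (simp_all del: of_nat_0_less_iff)
    have "norm (exp (X ^ p) * H X) \<le> C1 / norm X ^ M \<or> norm (exp (X ^ p) * H X) \<le> C2 / norm X ^ M"
    proof (cases "0 \<le> Arg X")
      case True
      then have "0 \<le> p * Arg X"
        using p by simp
      then have "\<bar>\<theta>1 - p * Arg X\<bar> \<le> \<omega>1"
        using A \<theta>1 unfolding \<omega>1_def by linarith
      then show ?thesis
        using 1[of X] X by auto
    next
      case False
      then have "p * Arg X \<le> 0"
        using p by (simp add: mult_nonneg_nonpos)
      then have "\<bar>\<theta>2 - p * Arg X\<bar> \<le> \<omega>2"
        using A \<theta>2 unfolding \<omega>2_def by linarith
      then show ?thesis
        using 2[of X] X by auto
    qed
    then show "norm (exp (X ^ p) * H X) \<le> max C1 C2 / norm X ^ M"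
      by (elim disjE order_trans) (auto intro: divide_right_mono)
  qed
qed

end

section \<open>The fast equation: formal series, unique bounded solution, existence\<close>

lemma convergent_at_top_if_majorized:
  fixes h :: "real \<Rightarrow> complex"
  assumes bound: "\<And>a b. R \<le> a \<Longrightarrow> a \<le> b \<Longrightarrow> norm (h b - h a) \<le> \<phi> a" and lim: "(\<phi> \<longlongrightarrow> 0) at_top"
  shows "\<exists>L. (h \<longlongrightarrow> L) at_top"
proof -
  have "cauchy_filter (filtermap h at_top)"
    unfolding cauchy_filter_metric_filtermap
  proof (intro allI impI)
    fix e :: real assume "e > 0"
    then have "\<forall>\<^sub>F a in at_top. dist (\<phi> a) 0 < e / 2"
      using tendstoD[OF lim, of "e / 2"] by simp
    then obtain a where a: "R \<le> a" "\<phi> a < e / 2"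
      using eventually_happens[OF eventually_conj[OF _ eventually_ge_at_top[of R]]] by fastforce
    have "dist (h x) (h y) < e" if "a \<le> x" "a \<le> y" for x y
    proof -
      have "dist (h x) (h y) \<le> norm (h x - h a) + norm (h y - h a)"
        using norm_triangle_ineq4[of "h x - h a" "h y - h a"] by (simp add: dist_norm)
      also have "\<dots> \<le> \<phi> a + \<phi> a"
        using bound a that by (intro add_mono) auto
      finally show ?thesis
        using a by simp
    qed
    then show "\<exists>P. eventually P at_top \<and> (\<forall>x y. P x \<and> P y \<longrightarrow> dist (h x) (h y) < e)"
      by (intro exI[of _ "\<lambda>x. a \<le> x"]) auto
  qed
  then have "\<exists>L. filtermap h at_top \<le> nhds L"
    by (rule cauchy_filter_complete_converges[OF _ complete_UNIV]) (auto simp: filtermap_bot_iff)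
  then show ?thesis
    by (simp add: filterlim_def)
qed

lemma exp_neg_power_tendsto_0:
  assumes "p > 0"
  shows "((\<lambda>t::real. exp (- (t ^ p))) \<longlongrightarrow> 0) at_top"
  by (rule filterlim_compose[OF exp_at_bot])
     (use assms filterlim_pow_at_top[OF assms filterlim_ident] in \<open>simp add: filterlim_uminus_at_bot\<close>)

text \<open>The coefficients of the formal solution \<open>\<Sum> c\<^sub>\<nu> X\<^sup>-\<^sup>\<nu>\<close>
  of \<open>g' = p X\<^sup>p\<^sup>-\<^sup>1 g - p \<Sum> b\<^sub>\<nu> X\<^sup>p\<^sup>-\<^sup>1\<^sup>-\<^sup>\<nu> + \<Sum> d\<^sub>\<nu> X\<^sup>-\<^sup>\<nu>\<close>.\<close>

fun formal_coeff :: "nat \<Rightarrow> (nat \<Rightarrow> complex) \<Rightarrow> (nat \<Rightarrow> complex) \<Rightarrow> nat \<Rightarrow> complex" where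
  "formal_coeff p b d \<nu> =
     (if \<nu> = 0 then 0
      else if p = 0 \<or> \<nu> < p then b \<nu>
      else - (d (\<nu> - p + 1) + of_nat (\<nu> - p) * formal_coeff p b d (\<nu> - p)) / of_nat p)"

declare formal_coeff.simps [simp del]

lemma formal_coeff_simps:
  "formal_coeff p b d 0 = 0"
  "0 < \<nu> \<Longrightarrow> \<nu> < p \<Longrightarrow> formal_coeff p b d \<nu> = b \<nu>"
  "0 < p \<Longrightarrow> of_nat p * formal_coeff p b d (p + j) = - (d (Suc j) + of_nat j * formal_coeff p b d j)"
  by (subst formal_coeff.simps; simp)+

text \<open>The factor X^(p-1) moves the term of index p+j to the power -(j+1), so N+p terms are
  needed to match N orders. The coefficients below index p cancel the polynomial, the recursion
  cancels the orders 1 to N of the derivative; only the derivative of the last p terms and the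
  forcing remain.\<close>

lemma formal_remainder:
  fixes X :: complex and b d :: "nat \<Rightarrow> complex"
  assumes "0 < p" "X \<noteq> 0" "d 0 = 0"
  defines "c \<equiv> formal_coeff p b d"
  shows "of_nat p * X ^ (p - 1) * (\<Sum>\<nu><N + p. c \<nu> / X ^ \<nu>)
     - of_nat p * (\<Sum>\<nu>=1..p - 1. b \<nu> * X ^ (p - 1 - \<nu>))
     + (\<Sum>\<nu><N + p. of_nat \<nu> * c \<nu> / X ^ Suc \<nu>)
   = - (\<Sum>\<nu><Suc N. d \<nu> / X ^ \<nu>) + (\<Sum>\<nu>\<in>{N..<N + p}. of_nat \<nu> * c \<nu> / X ^ Suc \<nu>)"
proof -
  have split: "(\<Sum>\<nu><N + p. F \<nu>) = (\<Sum>\<nu><p. F \<nu>) + (\<Sum>j<N. F (p + j))" for F :: "nat \<Rightarrow> complex"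
    by (induction N) (simp_all add: add_ac)
  have "of_nat p * X ^ (p - 1) * (\<Sum>\<nu><p. c \<nu> / X ^ \<nu>) = of_nat p * (\<Sum>\<nu>=1..p - 1. b \<nu> * X ^ (p - 1 - \<nu>))"
  proof -
    have "{..<p} = insert 0 {1..p - 1}"
      using assms by auto
    then have "(\<Sum>\<nu><p. c \<nu> / X ^ \<nu>) = c 0 + (\<Sum>\<nu>=1..p - 1. c \<nu> / X ^ \<nu>)"
      by simp
    also have "(\<Sum>\<nu>=1..p - 1. c \<nu> / X ^ \<nu>) = (\<Sum>\<nu>=1..p - 1. b \<nu> / X ^ \<nu>)"
    proof (rule sum.cong[OF refl])
      fix \<nu> assume "\<nu> \<in> {1..p - 1}"
      then have "0 < \<nu>" "\<nu> < p"
        using assms by auto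
      then show "c \<nu> / X ^ \<nu> = b \<nu> / X ^ \<nu>"
        unfolding c_def by (simp only: formal_coeff_simps(2))
    qed
    finally have "(\<Sum>\<nu><p. c \<nu> / X ^ \<nu>) = (\<Sum>\<nu>=1..p - 1. b \<nu> / X ^ \<nu>)"
      unfolding c_def by (simp only: formal_coeff_simps(1) add_0)
    moreover have "X ^ (p - 1) * (\<Sum>\<nu>=1..p - 1. b \<nu> / X ^ \<nu>) = (\<Sum>\<nu>=1..p - 1. b \<nu> * X ^ (p - 1 - \<nu>))"
      unfolding sum_distrib_left using assms by (intro sum.cong) (auto simp: power_diff)
    ultimately show ?thesis
      by (simp add: mult.assoc)
  qed
  moreover have "of_nat p * X ^ (p - 1) * (\<Sum>j<N. c (p + j) / X ^ (p + j))
      = - (\<Sum>j<N. d (Suc j) / X ^ Suc j) - (\<Sum>j<N. of_nat j * c j / X ^ Suc j)"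
  proof -
    have "of_nat p * X ^ (p - 1) * (c (p + j) / X ^ (p + j)) = - (d (Suc j) / X ^ Suc j) - of_nat j * c j / X ^ Suc j" for j
    proof -
      have "X ^ (p - 1) / X ^ (p + j) = 1 / X ^ Suc j"
        using assms power_add[of X "p - 1" "Suc j"] by (simp add: field_simps)
      then have "of_nat p * X ^ (p - 1) * (c (p + j) / X ^ (p + j)) = (of_nat p * c (p + j)) * (1 / X ^ Suc j)"
        by (metis (no_types, lifting) mult.assoc mult.commute times_divide_eq_right)
      also have "\<dots> = - (d (Suc j) + of_nat j * c j) * (1 / X ^ Suc j)"
        unfolding c_def by (simp only: formal_coeff_simps(3)[OF assms(1)])
      also have "\<dots> = - (d (Suc j) / X ^ Suc j) - of_nat j * c j / X ^ Suc j"
        by (simp add: add_divide_distrib diff_divide_distrib)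
      finally show ?thesis .
    qed
    then show ?thesis
      by (simp add: sum_distrib_left sum_subtractf sum_negf)
  qed
  moreover have "(\<Sum>\<nu><Suc N. d \<nu> / X ^ \<nu>) = (\<Sum>j<N. d (Suc j) / X ^ Suc j)"
    unfolding sum.lessThan_Suc_shift using assms by simp
  moreover have "(\<Sum>\<nu><N + p. of_nat \<nu> * c \<nu> / X ^ Suc \<nu>)
     = (\<Sum>\<nu><N. of_nat \<nu> * c \<nu> / X ^ Suc \<nu>) + (\<Sum>\<nu>\<in>{N..<N + p}. of_nat \<nu> * c \<nu> / X ^ Suc \<nu>)"
    by (simp add: lessThan_atLeast0 sum.atLeastLessThan_concat)
  ultimately show ?thesis
    unfolding split[of "\<lambda>\<nu>. c \<nu> / X ^ \<nu>"] distrib_left by simp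
qed

context quasi_sector_equation begin

text \<open>The product d exp(-X^p) has derivative 0 on the connected set V and is a constant. On
  the positive axis its modulus is at most B exp(-t^p), which tends to 0.\<close>

lemma bounded_homogeneous_solution_zero:
  assumes d: "\<And>X. X \<in> V \<Longrightarrow> (d has_field_derivative of_nat p * X ^ (p - 1) * d X) (at X)"
    and bd: "bounded (d ` V)" and X: "X \<in> V"
  shows "d X = 0"
proof -
  have "((\<lambda>X. d X * exp (- (X ^ p))) has_field_derivative 0) (at X)" if "X \<in> V" for X
    by (rule derivative_eq_intros d that refl)+ simp
  then have "(\<lambda>X. d X * exp (- (X ^ p))) constant_on V"
    using connected_V open_V by (rule has_field_derivative_0_imp_constant_on)
  then obtain k where k: "\<And>X. X \<in> V \<Longrightarrow> d X * exp (- (X ^ p)) = k"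
    unfolding constant_on_def by auto
  obtain B where B: "\<And>X. X \<in> V \<Longrightarrow> norm (d X) \<le> B"
    using bd unfolding bounded_iff by auto
  have "norm k \<le> 0"
  proof (rule tendsto_lowerbound)
    show "((\<lambda>t::real. B * exp (- (t ^ p))) \<longlongrightarrow> 0) at_top"
      using p_ge_2 by (intro tendsto_mult_right_zero exp_neg_power_tendsto_0) auto
    show "\<forall>\<^sub>F t in at_top. norm k \<le> B * exp (- (t ^ p))"
    proof (rule eventually_mono[OF eventually_gt_at_top[of "\<bar>\<mu>\<bar>"]])
      fix t assume "\<bar>\<mu>\<bar> < t"
      then have t: "of_real t \<in> V"
        by (rule of_real_in_V)
      have "norm k = norm (d (of_real t)) * norm (exp (- (of_real t ^ p) :: complex))"
        unfolding k[OF t, symmetric] norm_mult ..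
      also have "\<dots> = norm (d (of_real t)) * exp (- (t ^ p))"
        by (simp flip: of_real_power)
      also have "\<dots> \<le> B * exp (- (t ^ p))"
        using B[OF t] by (intro mult_right_mono) auto
      finally show "norm k \<le> B * exp (- (t ^ p))" .
    qed
  qed simp
  then show ?thesis
    using k[OF X] by simp
qed

lemma primitive_bounded:
  assumes H: "\<And>t. t \<in> V \<Longrightarrow> (H has_field_derivative exp (- (t ^ p)) * f t) (at t)"
    and f: "\<And>R. bounded (f ` {t\<in>V. norm t \<le> R})"
    and large: "\<And>X. X \<in> V \<Longrightarrow> R1 \<le> norm X \<Longrightarrow> norm (exp (X ^ p) * H X) \<le> C"
  shows "bounded ((\<lambda>X. exp (X ^ p) * H X) ` {X\<in>V. norm X \<le> R})"
proof -
  define R2 where "R2 = max R (max R1 (\<bar>\<mu>\<bar> + 1))"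
  have exp_le: "norm (exp (X ^ p)) \<le> exp (R2 ^ p)" "norm (exp (- (X ^ p))) \<le> exp (R2 ^ p)"
    if "norm X \<le> R2" for X :: complex
  proof -
    have "norm (X ^ p) \<le> R2 ^ p"
      using that by (simp add: norm_power power_mono)
    then show "norm (exp (X ^ p)) \<le> exp (R2 ^ p)" "norm (exp (- (X ^ p))) \<le> exp (R2 ^ p)"
      using abs_Re_le_cmod[of "X ^ p"] by auto
  qed
  obtain F where F: "\<And>t. t \<in> V \<Longrightarrow> norm t \<le> R2 \<Longrightarrow> norm (f t) \<le> F"
    using f[of R2] unfolding bounded_iff by auto
  have mv: "norm (H X - H Y) \<le> exp (R2 ^ p) * F * norm (X - Y)"
    if "closed_segment X Y \<subseteq> V" "norm X \<le> R2" "norm Y \<le> R2" for X Y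
  proof (rule field_differentiable_bound[OF convex_closed_segment])
    fix t assume t: "t \<in> closed_segment X Y"
    then have tV: "t \<in> V"
      using that by auto
    show "(H has_field_derivative exp (- (t ^ p)) * f t) (at t within closed_segment X Y)"
      using H[OF tV] by (rule has_field_derivative_at_within)
    have "closed_segment X Y \<subseteq> cball 0 R2"
      using that by (intro closed_segment_subset) auto
    then have "norm t \<le> R2"
      using t by auto
    then show "norm (exp (- (t ^ p)) * f t) \<le> exp (R2 ^ p) * F"
      unfolding norm_mult using exp_le F tV by (intro mult_mono) auto
  qed auto
  have "\<exists>K. \<forall>X\<in>V. norm X \<le> R \<longrightarrow> norm (H X) \<le> K"
  proof (cases "0 < \<mu>")
    case True
    have "norm (H X) \<le> norm (H 0) + exp (R2 ^ p) * F * R2" if "X \<in> V" "norm X \<le> R" for X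
    proof -
      have X: "norm X \<le> R2"
        using that by (simp add: R2_def)
      then have "norm (H X - H 0) \<le> exp (R2 ^ p) * F * norm (X - 0)"
        using starlike_V(2)[OF True that(1)]
        by (intro mv) (auto simp: closed_segment_commute order.trans[OF norm_ge_zero X])
      also have "\<dots> \<le> exp (R2 ^ p) * F * R2"
        using X order.trans[OF norm_ge_zero F[OF that(1) X]] by (intro mult_left_mono) auto
      finally show ?thesis
        using norm_triangle_ineq2[of "H X" "H 0"] by simp
    qed
    then show ?thesis
      by blast
  next
    case False
    then have \<mu>: "\<mu> < 0"
      using \<mu>_nonzero by auto
    have "norm (H X) \<le> exp (R2 ^ p) * C + exp (R2 ^ p) * F * (2 * R2)" if "X \<in> V" "norm X \<le> R" for X
    proof -
      have X: "norm X \<le> R2" "X \<noteq> 0"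
        using that \<mu> by (auto simp: R2_def V_iff)
      define Y where "Y = of_real (R2 / norm X) * X"
      have Y: "norm Y = R2"
        using X order.trans[OF norm_ge_zero X(1)] by (simp add: Y_def norm_mult norm_divide)
      have seg: "closed_segment X Y \<subseteq> V"
      proof
        fix t assume "t \<in> closed_segment X Y"
        then obtain u where u: "0 \<le> u" "u \<le> 1" "t = of_real (1 - u) * X + of_real u * Y"
          by (auto simp: in_segment scaleR_conv_of_real)
        define k where "k = 1 + u * (R2 / norm X - 1)"
        have "t = of_real k * X"
          using u by (simp add: k_def Y_def algebra_simps)
        moreover have "1 \<le> k"
          using u X by (simp add: k_def le_divide_eq)
        ultimately show "t \<in> V"
          using scale_in_V[OF that(1)] X \<mu> by auto
      qed
      then have "Y \<in> V"
        by auto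
      have "norm (H Y) = norm (exp (- (Y ^ p))) * norm (exp (Y ^ p) * H Y)"
        by (simp add: exp_minus field_simps flip: norm_mult)
      also have "\<dots> \<le> exp (R2 ^ p) * C"
        using exp_le(2)[of Y] Y large[OF \<open>Y \<in> V\<close>] by (intro mult_mono) (simp_all add: R2_def)
      finally have "norm (H Y) \<le> exp (R2 ^ p) * C" .
      moreover have "norm (H X - H Y) \<le> exp (R2 ^ p) * F * norm (X - Y)"
        using X Y by (intro mv seg) auto
      moreover have "\<dots> \<le> exp (R2 ^ p) * F * (2 * R2)"
        using X Y norm_triangle_ineq4[of X Y] order.trans[OF norm_ge_zero F[OF that(1) X(1)]]
        by (intro mult_left_mono) auto
      ultimately show ?thesis
        using norm_triangle_ineq2[of "H X" "H Y"] by linarith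
    qed
    then show ?thesis
      by blast
  qed
  then obtain K where K: "\<And>X. X \<in> V \<Longrightarrow> norm X \<le> R \<Longrightarrow> norm (H X) \<le> K"
    by blast
  have "norm (exp (X ^ p) * H X) \<le> exp (R2 ^ p) * K" if "X \<in> V" "norm X \<le> R" for X
    unfolding norm_mult using exp_le(1)[of X] K that by (intro mult_mono) (auto simp: R2_def)
  then show ?thesis
    unfolding bounded_iff by auto
qed

text \<open>The integrating factor exp(-X^p) reduces the equation to finding a primitive. The
  numbers b are free parameters; once they are the leading coefficients of g, the right-hand side is
  p T^(p-1) g + G, the form in which the fast equation arises.\<close>

lemma ex_fast_solution:
  assumes G: "G \<in> fast_space V"
  shows "\<exists>g\<in>fast_space V. (\<forall>\<nu>. 0 < \<nu> \<and> \<nu> < p \<longrightarrow> asym_coeff V g \<nu> = b \<nu>) \<and>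
    (\<forall>X\<in>V. (g has_field_derivative of_nat p * X ^ (p - 1) * g X
       - of_nat p * (\<Sum>\<nu>=1..p - 1. b \<nu> * X ^ (p - 1 - \<nu>)) + G X) (at X))"
proof -
  define q where "q = (\<lambda>X::complex. of_nat p * (\<Sum>\<nu>=1..p - 1. b \<nu> * X ^ (p - 1 - \<nu>)))"
  define f where "f = (\<lambda>X. G X - q X)"
  define d where "d = asym_coeff V G"
  define c where "c = formal_coeff p b d"
  have p: "0 < p"
    using p_ge_2 by auto
  have d: "has_asymptotics V G d" "d 0 = 0"
    using fast_space_asymptotics[OF infinity_in_V G] asym_coeff_0[OF infinity_in_V G] by (auto simp: d_def)
  have q_holo: "q holomorphic_on A" for A
    unfolding q_def by (intro holomorphic_intros)
  have "(\<lambda>X. exp (- (X ^ p)) * f X) holomorphic_on V"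
    using G q_holo unfolding f_def fast_space_def by (auto intro!: holomorphic_intros)
  then obtain H0 where H0: "\<And>X. X \<in> V \<Longrightarrow> (H0 has_field_derivative exp (- (X ^ p)) * f X) (at X)"
    using primitive_on_V by blast
  obtain B where B: "\<And>X. X \<in> V \<Longrightarrow> norm (G X) \<le> B"
    using G unfolding fast_space_def bounded_iff by auto
  then have "0 \<le> B"
    using order.trans[OF norm_ge_zero B[OF of_real_in_V[of "\<bar>\<mu>\<bar> + 1"]]] by simp
  define B1 where "B1 = B + p * (\<Sum>\<nu>=1..p - 1. norm (b \<nu>))"
  have "0 \<le> B1"
    unfolding B1_def using \<open>0 \<le> B\<close> by (intro add_nonneg_nonneg mult_nonneg_nonneg sum_nonneg) auto
  \<comment> \<open>The polynomial has degree at most p-2. The cruder power p-1 is taken because B1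
    x^(p-1) exp(-x^p) has the explicit primitive -(B1/p) exp(-x^p), which serves as majorant on the
    positive axis.\<close>
  have f_le: "norm (f X) \<le> B1 * norm X ^ (p - 1)" if "X \<in> V" "1 \<le> norm X" for X
  proof -
    have "norm (\<Sum>\<nu>=1..p - 1. b \<nu> * X ^ (p - 1 - \<nu>)) \<le> (\<Sum>\<nu>=1..p - 1. norm (b \<nu>) * norm X ^ (p - 1))"
      using that by (intro sum_norm_le) (auto simp: norm_mult norm_power intro!: mult_left_mono power_increasing)
    then have "norm (q X) \<le> p * (\<Sum>\<nu>=1..p - 1. norm (b \<nu>)) * norm X ^ (p - 1)"
      by (simp add: q_def norm_mult mult_left_mono sum_distrib_right mult.assoc)
    moreover have "norm (G X) \<le> B * norm X ^ (p - 1)"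
      using B[OF that(1)] mult_left_mono[OF one_le_power[OF that(2), of "p - 1"] \<open>0 \<le> B\<close>] by simp
    ultimately show ?thesis
      using norm_triangle_ineq4[of "G X" "q X"] by (simp add: f_def B1_def algebra_simps)
  qed
  have f_bounded: "bounded (f ` {t\<in>V. norm t \<le> R})" for R
  proof -
    have "bounded (q ` cball 0 R)"
      by (intro compact_imp_bounded compact_continuous_image holomorphic_on_imp_continuous_on q_holo) auto
    then obtain B' where "\<forall>z\<in>q ` cball 0 R. norm z \<le> B'"
      unfolding bounded_iff by blast
    then have "norm (q t) \<le> B'" if "norm t \<le> R" for t
      using that by simp
    then have "norm (f t) \<le> B + B'" if "t \<in> V" "norm t \<le> R" for t
      unfolding f_def using B that by (intro norm_triangle_le_diff add_mono) auto
    then show ?thesis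
      unfolding bounded_iff by auto
  qed
  have "\<exists>L. ((\<lambda>t. H0 (of_real t)) \<longlongrightarrow> L) at_top"
  proof (rule convergent_at_top_if_majorized)
    show "((\<lambda>t::real. B1 / p * exp (- (t ^ p))) \<longlongrightarrow> 0) at_top"
      by (intro tendsto_mult_right_zero exp_neg_power_tendsto_0 p)
    fix s t :: real assume st: "\<bar>\<mu>\<bar> + 1 \<le> s" "s \<le> t"
    have "norm (H0 (of_real t) - H0 (of_real s)) \<le> - (B1 / p) * exp (- (t ^ p)) - (- (B1 / p) * exp (- (s ^ p)))"
      if "s < t"
      using that
    proof (rule differentiable_bound_general)
      have H': "((\<lambda>x. H0 (of_real x)) has_vector_derivative exp (- (of_real x ^ p)) * f (of_real x)) (at x)"
        if "s \<le> x" for x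
        using st that by (intro has_vector_derivative_real_field H0 of_real_in_V) auto
      show "((\<lambda>x. H0 (of_real x)) has_vector_derivative exp (- (of_real x ^ p)) * f (of_real x)) (at x)"
        if "s < x" for x
        using H' that by simp
      show "continuous_on {s..t} (\<lambda>x. H0 (complex_of_real x))"
        using H' by (auto intro!: continuous_at_imp_continuous_on has_vector_derivative_continuous)
      show "((\<lambda>x. - (B1 / p) * exp (- (x ^ p))) has_vector_derivative B1 * x ^ (p - 1) * exp (- (x ^ p))) (at x)"
        for x :: real
        unfolding has_real_derivative_iff_has_vector_derivative[symmetric]
        using p by (auto intro!: derivative_eq_intros)
      show "norm (exp (- (of_real x ^ p)) * f (of_real x)) \<le> B1 * x ^ (p - 1) * exp (- (x ^ p))"
        if "s < x" for x
      proof -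
        have "norm (f (of_real x)) \<le> B1 * x ^ (p - 1)"
          using f_le[OF of_real_in_V[of x]] st that by simp
        then show ?thesis
          by (simp add: norm_mult mult.commute mult_right_mono flip: of_real_power)
      qed
    qed (intro continuous_intros)
    then show "norm (H0 (of_real t) - H0 (of_real s)) \<le> B1 / p * exp (- (s ^ p))"
      using st \<open>0 \<le> B1\<close> by (cases "s = t") (auto elim!: order_trans)
  qed
  then obtain L where L: "((\<lambda>t. H0 (of_real t)) \<longlongrightarrow> L) at_top"
    by blast
  \<comment> \<open>Subtracting the limit selects the bounded solution: \<open>H X\<close> is minus
    the integral of exp(-t^p) f(t) from X to infinity.\<close>
  define H where "H = (\<lambda>X. H0 X - L)"
  have H: "(H has_field_derivative exp (- (X ^ p)) * f X) (at X)" if "X \<in> V" for X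
    unfolding H_def using H0[OF that] by (auto intro!: derivative_eq_intros)
  have H_lim: "((\<lambda>t. H (of_real t)) \<longlongrightarrow> 0) at_top"
    unfolding H_def using tendsto_diff[OF L tendsto_const[of L]] by simp
  define g where "g = (\<lambda>X. exp (X ^ p) * H X)"
  have g': "(g has_field_derivative of_nat p * X ^ (p - 1) * g X + f X) (at X)" if "X \<in> V" for X
    unfolding g_def
    by (rule derivative_eq_intros H[OF that] refl)+ (simp add: exp_minus field_simps)
  \<comment> \<open>Here N+p terms are taken off for an error of order N only. The p surplus terms
    are themselves O(X^-N) and are put back afterwards.\<close>
  have asym: "(\<lambda>X. g X - (\<Sum>\<nu><N + p. c \<nu> / X ^ \<nu>)) \<in> O[infinity_in V](\<lambda>X. 1 / X ^ N)" for N
  proof -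
    define s where "s = (\<lambda>X::complex. \<Sum>\<nu><N + p. c \<nu> / X ^ \<nu>)"
    define s' where "s' = (\<lambda>X::complex. - (\<Sum>\<nu><N + p. of_nat \<nu> * c \<nu> / X ^ Suc \<nu>))"
    \<comment> \<open>The defect of the partial sum in the differential equation: exp(-X^p) r is the
      derivative of H - exp(-X^p) s.\<close>
    define r where "r = (\<lambda>X. f X + of_nat p * X ^ (p - 1) * s X - s' X)"
    have s_deriv: "(s has_field_derivative s' X) (at X)" if "X \<noteq> 0" for X
      unfolding s_def s'_def sum_negf[symmetric]
    proof (rule DERIV_sum)
      fix \<nu>
      have *: "- (c \<nu> * (of_nat \<nu> * X ^ (\<nu> - 1))) / (X ^ \<nu> * X ^ \<nu>) = - (of_nat \<nu> * c \<nu> / X ^ Suc \<nu>)"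
        using that by (cases \<nu>) (simp_all add: field_simps)
      have "((\<lambda>X. c \<nu> / X ^ \<nu>) has_field_derivative - (c \<nu> * (of_nat \<nu> * X ^ (\<nu> - 1))) / (X ^ \<nu> * X ^ \<nu>)) (at X)"
        using that by (auto intro!: derivative_eq_intros)
      then show "((\<lambda>X. c \<nu> / X ^ \<nu>) has_field_derivative - (of_nat \<nu> * c \<nu> / X ^ Suc \<nu>)) (at X)"
        unfolding *[symmetric] .
    qed
    have r_eq: "r X = (G X - (\<Sum>\<nu><Suc N. d \<nu> / X ^ \<nu>)) + (\<Sum>\<nu>\<in>{N..<N + p}. of_nat \<nu> * c \<nu> / X ^ Suc \<nu>)"
      if "X \<noteq> 0" for X
    proof -
      have "of_nat p * X ^ (p - 1) * s X - q X - s' X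
          = - (\<Sum>\<nu><Suc N. d \<nu> / X ^ \<nu>) + (\<Sum>\<nu>\<in>{N..<N + p}. of_nat \<nu> * c \<nu> / X ^ Suc \<nu>)"
        using formal_remainder[where b = b and d = d and N = N, OF p that d(2)]
        unfolding s_def q_def s'_def c_def diff_minus_eq_add .
      moreover have "r X = G X + (of_nat p * X ^ (p - 1) * s X - q X - s' X)"
        by (simp add: r_def f_def)
      ultimately show ?thesis
        by (simp only: diff_conv_add_uminus add.assoc)
    qed
    have "(\<lambda>X. (G X - (\<Sum>\<nu><Suc N. d \<nu> / X ^ \<nu>)) + (\<Sum>\<nu>\<in>{N..<N + p}. of_nat \<nu> * c \<nu> / X ^ Suc \<nu>))
        \<in> O[infinity_in V](\<lambda>X. 1 / X ^ N)"
      by (intro sum_in_bigo(1) has_asymptotics_tail[OF d(1)] sum_tail_bigo) auto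
    then obtain C R where CR: "0 < C" "\<And>X. X \<in> V \<Longrightarrow> R \<le> norm X \<Longrightarrow>
        norm ((G X - (\<Sum>\<nu><Suc N. d \<nu> / X ^ \<nu>)) + (\<Sum>\<nu>\<in>{N..<N + p}. of_nat \<nu> * c \<nu> / X ^ Suc \<nu>)) \<le> C * norm (1 / X ^ N)"
      by (elim landau_o.bigE) (auto simp: eventually_infinity_in)
    have "\<exists>C' R'. \<forall>X\<in>V. R' \<le> norm X \<longrightarrow> norm (exp (X ^ p) * (H X - exp (- (X ^ p)) * s X)) \<le> C' / norm X ^ N"
    proof (rule primitive_decay)
      fix X assume X: "X \<in> V" "max R 1 \<le> norm X"
      then have "X \<noteq> 0"
        by auto
      show "((\<lambda>X. H X - exp (- (X ^ p)) * s X) has_field_derivative exp (- (X ^ p)) * r X) (at X)"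
        by (rule derivative_eq_intros H[OF X(1)] s_deriv[OF \<open>X \<noteq> 0\<close>] refl)+ (simp add: r_def algebra_simps)
      show "norm (r X) \<le> C / norm X ^ N"
        using CR(2)[OF X(1)] X unfolding r_eq[OF \<open>X \<noteq> 0\<close>] by (simp add: norm_divide norm_power)
    next
      have "((\<lambda>t. exp (- (of_real t ^ p)) * s (of_real t)) \<longlongrightarrow> 0) at_top"
      proof (rule Lim_null_comparison)
        show "((\<lambda>t::real. (\<Sum>\<nu><N + p. norm (c \<nu>)) * exp (- (t ^ p))) \<longlongrightarrow> 0) at_top"
          by (intro tendsto_mult_right_zero exp_neg_power_tendsto_0 p)
        show "\<forall>\<^sub>F t in at_top. norm (exp (- (of_real t ^ p)) * s (of_real t)) \<le> (\<Sum>\<nu><N + p. norm (c \<nu>)) * exp (- (t ^ p))"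
        proof (rule eventually_mono[OF eventually_ge_at_top[of 1]])
          fix t :: real assume t: "1 \<le> t"
          have "norm (s (of_real t)) \<le> (\<Sum>\<nu><N + p. norm (c \<nu>))"
            unfolding s_def
          proof (rule sum_norm_le)
            fix \<nu>
            show "norm (c \<nu> / of_real t ^ \<nu>) \<le> norm (c \<nu>)"
              using t one_le_power[OF t, of \<nu>] by (simp add: norm_divide norm_power divide_le_eq mult_le_cancel_left1)
          qed
          then show "norm (exp (- (of_real t ^ p)) * s (of_real t)) \<le> (\<Sum>\<nu><N + p. norm (c \<nu>)) * exp (- (t ^ p))"
            by (simp add: norm_mult mult.commute mult_left_mono flip: of_real_power)
        qed
      qed
      then show "((\<lambda>t. H (of_real t) - exp (- (of_real t ^ p)) * s (of_real t)) \<longlongrightarrow> 0) at_top"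
        using tendsto_diff[OF H_lim] by fastforce
    qed (use CR in auto)
    then obtain C' R' where C': "\<And>X. X \<in> V \<Longrightarrow> R' \<le> norm X \<Longrightarrow>
        norm (exp (X ^ p) * (H X - exp (- (X ^ p)) * s X)) \<le> C' / norm X ^ N"
      by blast
    have "exp (X ^ p) * (H X - exp (- (X ^ p)) * s X) = g X - s X" for X
      by (simp add: g_def exp_minus field_simps)
    then show ?thesis
      using C' by (intro bigoI[of _ C']) (auto simp: eventually_infinity_in norm_divide norm_power s_def)
  qed
  have g_asym: "has_asymptotics V g c"
    unfolding has_asymptotics_def
  proof (intro conjI allI)
    fix N
    have "(\<lambda>X. (g X - (\<Sum>\<nu><N + p. c \<nu> / X ^ \<nu>)) + (\<Sum>\<nu>\<in>{N..<N + p}. c \<nu> / X ^ \<nu>)) \<in> O[infinity_in V](\<lambda>X. 1 / X ^ N)"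
      by (intro sum_in_bigo(1) asym sum_tail_bigo) auto
    moreover have "(\<Sum>\<nu><N + p. c \<nu> / X ^ \<nu>) = (\<Sum>\<nu><N. c \<nu> / X ^ \<nu>) + (\<Sum>\<nu>\<in>{N..<N + p}. c \<nu> / X ^ \<nu>)" for X
      by (simp add: lessThan_atLeast0 sum.atLeastLessThan_concat)
    ultimately show "(\<lambda>X. g X - (\<Sum>\<nu><N. c \<nu> / X ^ \<nu>)) \<in> O[infinity_in V](\<lambda>X. 1 / X ^ N)"
      by (simp add: algebra_simps)
  qed (simp add: c_def formal_coeff_simps)
  have "bounded (g ` V)"
  proof (rule bounded_if_bigo_1[OF has_asymptotics_bigo_1[OF g_asym]])
    obtain C R1 where "\<And>X. X \<in> V \<Longrightarrow> R1 \<le> norm X \<Longrightarrow> norm (g X) \<le> C"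
      using has_asymptotics_bigo_1[OF g_asym]
      by (elim landau_o.bigE) (auto simp: eventually_infinity_in)
    then show "bounded (g ` {X\<in>V. norm X \<le> R})" for R
      unfolding g_def by (intro primitive_bounded[OF H f_bounded]) auto
  qed
  moreover have "g holomorphic_on V"
    unfolding holomorphic_on_def field_differentiable_def
    using g' has_field_derivative_at_within by blast
  ultimately have "g \<in> fast_space V"
    using g_asym by (auto simp: fast_space_def)
  moreover have "asym_coeff V g = c"
    using g_asym by (rule asym_coeff_eqI[OF infinity_in_V])
  moreover have "c \<nu> = b \<nu>" if "0 < \<nu>" "\<nu> < p" for \<nu>
    using that by (simp add: c_def formal_coeff_simps(2))
  moreover have "(g has_field_derivative of_nat p * X ^ (p - 1) * g X
      - of_nat p * (\<Sum>\<nu>=1..p - 1. b \<nu> * X ^ (p - 1 - \<nu>)) + G X) (at X)" if "X \<in> V" for X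
  proof -
    have "of_nat p * X ^ (p - 1) * g X + f X
      = of_nat p * X ^ (p - 1) * g X - of_nat p * (\<Sum>\<nu>=1..p - 1. b \<nu> * X ^ (p - 1 - \<nu>)) + G X"
      by (simp add: f_def q_def)
    then show ?thesis
      using g'[OF that] by (simp only:)
  qed
  ultimately show ?thesis
    by blast
qed

end

section \<open>Slow functions and combined series\<close>

lemma shift_S_holomorphic:
  assumes "a holomorphic_on D" "open D"
  shows "shift_S a holomorphic_on D"
  using pole_lemma_open[OF assms, of 0] unfolding shift_S_def[abs_def] diff_0_right .

lemma shift_S_power_holomorphic:
  assumes "a holomorphic_on D" "open D"
  shows "(shift_S ^^ n) a holomorphic_on D"
  by (induction n) (use assms shift_S_holomorphic in auto)

lemma shift_S_cong:
  assumes "open D" "0 \<in> D" "\<And>x. x \<in> D \<Longrightarrow> a x = b x" "x \<in> D"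
  shows "shift_S a x = shift_S b x"
proof -
  have "deriv a 0 = deriv b 0"
    using assms by (intro deriv_cong_ev) (auto simp: eventually_nhds)
  then show ?thesis
    using assms by (simp add: shift_S_def)
qed

lemma shift_S_power_cong:
  assumes "open D" "0 \<in> D" "\<And>x. x \<in> D \<Longrightarrow> a x = b x" "x \<in> D"
  shows "(shift_S ^^ n) a x = (shift_S ^^ n) b x"
  using assms(4) by (induction n arbitrary: x) (auto simp: assms(3) intro!: shift_S_cong[OF assms(1,2)])

lemma taylor_coeff_cong:
  assumes "open D" "0 \<in> D" "\<And>x. x \<in> D \<Longrightarrow> a x = b x"
  shows "taylor_coeff a n = taylor_coeff b n"
proof -
  have "(deriv ^^ n) a 0 = (deriv ^^ n) b 0"
    using assms by (intro higher_deriv_cong_ev) (auto simp: eventually_nhds)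
  then show ?thesis
    by (simp add: taylor_coeff_def)
qed

text \<open>Iteration of h x = h 0 + x * shift_S h x. With k = p-1 it splits a residual into a
  polynomial, to be matched by coefficients of fast parts, and a multiple of x^(p-1), which is
  absorbed by the slow part.\<close>

lemma shift_S_expansion:
  "h x = (\<Sum>l<k. (shift_S ^^ l) h 0 * x ^ l) + x ^ k * (shift_S ^^ k) h x"
proof (induction k)
  case (Suc k)
  have "(shift_S ^^ k) h x = (shift_S ^^ k) h 0 + x * (shift_S ^^ Suc k) h x"
    by (simp add: shift_S_def[of "(shift_S ^^ k) h"])
  with Suc show ?case
    by (simp add: algebra_simps)
qed simp

lemma shift_S_const: "shift_S (\<lambda>x. c) = (\<lambda>x. 0)"
  by (simp add: shift_S_def fun_eq_iff)

lemma shift_S_power_zero: "(shift_S ^^ n) (\<lambda>x. 0) = (\<lambda>x. 0)"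
  by (induction n) (auto simp: shift_S_const)

lemma shift_S_power_monomial:
  "(shift_S ^^ n) (\<lambda>x. c * x ^ k) = (if n \<le> k then (\<lambda>x. c * x ^ (k - n)) else (\<lambda>x. 0))"
proof (induction n)
  case (Suc n)
  have mono: "shift_S (\<lambda>x. c * x ^ Suc m) = (\<lambda>x. c * x ^ m)" for m
  proof
    fix x :: complex
    have "deriv (\<lambda>x. c * x ^ Suc m) 0 = c * 0 ^ m"
      by (rule DERIV_imp_deriv) (auto intro!: derivative_eq_intros simp: power_0_left)
    then show "shift_S (\<lambda>x. c * x ^ Suc m) x = c * x ^ m"
      by (simp add: shift_S_def)
  qed
  show ?case
  proof (cases "Suc n \<le> k")
    case True
    then have "k - n = Suc (k - Suc n)"
      by simp
    then show ?thesis
      using Suc True mono[of "k - Suc n"] by simp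
  next
    case False
    then have "shift_S ((shift_S ^^ n) (\<lambda>x. c * x ^ k)) = (\<lambda>x. 0)"
      using Suc by (cases "n \<le> k") (auto simp: shift_S_const)
    then show ?thesis
      using False by simp
  qed
qed simp

lemma taylor_coeff_monomial: "taylor_coeff (\<lambda>x. c * x ^ k) n = (if n = k then c else 0)"
proof -
  have "(deriv ^^ n) (\<lambda>x. c * x ^ k) 0 = c * (deriv ^^ n) (\<lambda>x. (x - 0) ^ k) 0"
    by (subst higher_deriv_cmult[where A = UNIV]) (auto intro!: holomorphic_intros)
  also have "\<dots> = c * (pochhammer (of_nat (Suc k - n)) n * 0 ^ (k - n))"
    by (subst higher_deriv_power) simp
  finally show ?thesis
    by (cases n k rule: linorder_cases)
       (auto simp: taylor_coeff_def pochhammer_0_left pochhammer_fact[symmetric] power_0_left)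
qed

lemma taylor_coeff_zero: "taylor_coeff (\<lambda>x. 0) n = 0"
  using taylor_coeff_monomial[of 0 0 n] by simp

text \<open>At x = 0 the identity gives b 0 = 0; division by x and continuity at 0 lower k by one.
  Applied to the difference of two slow equations, it identifies the slow parts and the coefficients
  of the fast parts at once.\<close>

lemma polynomial_plus_remainder_zero:
  assumes A: "A holomorphic_on ball 0 r" and r: "r > 0"
    and eq: "\<And>x. x \<in> ball 0 r \<Longrightarrow> (\<Sum>l<k. b l * x ^ l) + x ^ k * A x = 0"
  shows "l < k \<Longrightarrow> b l = 0" and "x \<in> ball 0 r \<Longrightarrow> A x = 0"
proof -
  have "(\<forall>l<k. b l = 0) \<and> (\<forall>x\<in>ball 0 r. A x = 0)"
    using eq
  proof (induction k arbitrary: b)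
    case (Suc k)
    define B where "B = (\<lambda>x. (\<Sum>l<k. b (Suc l) * x ^ l) + x ^ k * A x)"
    have split: "(\<Sum>l<Suc k. b l * x ^ l) + x ^ Suc k * A x = b 0 + x * B x" for x
      by (simp add: B_def sum.lessThan_Suc_shift sum_distrib_left algebra_simps del: sum.lessThan_Suc)
    have eq: "b 0 + x * B x = 0" if "x \<in> ball 0 r" for x
      using Suc.prems[OF that] split by simp
    have b0: "b 0 = 0"
      using eq[of 0] r by simp
    have nz: "B x = 0" if "x \<in> ball 0 r" "x \<noteq> 0" for x
      using eq[of x] b0 that by simp
    have "isCont B 0"
      unfolding B_def using A r
      by (intro continuous_intros)
         (auto simp: continuous_on_eq_continuous_at[symmetric] dest!: holomorphic_on_imp_continuous_on
            intro: continuous_on_interior)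
    then have "(B \<longlongrightarrow> B 0) (at 0)"
      by (simp add: isCont_def)
    moreover have "(B \<longlongrightarrow> 0) (at 0)"
      by (rule Lim_transform_within_open[of "\<lambda>_. 0" 0 0 UNIV "ball 0 r"]) (use nz r in auto)
    ultimately have "B 0 = 0"
      by (rule LIM_unique)
    then have "(\<Sum>l<k. b (Suc l) * x ^ l) + x ^ k * A x = 0" if "x \<in> ball 0 r" for x
      using nz[OF that] by (cases "x = 0") (auto simp: B_def)
    from Suc.IH[OF this] show ?case
      using b0 by (auto simp: less_Suc_eq_0_disj)
  qed auto
  then show "l < k \<Longrightarrow> b l = 0" and "x \<in> ball 0 r \<Longrightarrow> A x = 0"
    by auto
qed

text \<open>A relation compatible with the operations on entries carries over to series up to each order.
  Instances: equality, and equality on \<open>D\<close> and \<open>V\<close> together with membership in the spaces.\<close>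

locale entry_relation =
  fixes V :: "complex set"
    and R :: "(complex \<Rightarrow> complex) \<times> (complex \<Rightarrow> complex) \<Rightarrow> (complex \<Rightarrow> complex) \<times> (complex \<Rightarrow> complex) \<Rightarrow> bool"
  assumes zero: "R 0 0"
    and add: "R u u' \<Longrightarrow> R v v' \<Longrightarrow> R (u + v) (u' + v')"
    and mult: "R u u' \<Longrightarrow> R v v' \<Longrightarrow> R (entry_mult V u v \<nu>) (entry_mult V u' v' \<nu>)"
begin

lemma sum: "(\<And>i. i \<in> I \<Longrightarrow> R (F i) (F' i)) \<Longrightarrow> R (\<Sum>i\<in>I. F i) (\<Sum>i\<in>I. F' i)"
  by (induction I rule: infinite_finite_induct) (auto intro: zero add)

lemma cs_slow: "R (a, 0) (a, 0) \<Longrightarrow> R (cs_slow a n) (cs_slow a n)"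
  using zero by (simp add: cs_slow_def)

lemma cs_mult:
  assumes "\<And>i. i \<le> n \<Longrightarrow> R (y i) (y' i)" "\<And>i. i \<le> n \<Longrightarrow> R (z i) (z' i)"
  shows "R (cs_mult V y z n) (cs_mult V y' z' n)"
  unfolding cs_mult_def using assms by (intro sum mult) auto

lemma cs_power:
  assumes "\<And>i. i \<le> n \<Longrightarrow> R (y i) (y' i)" "R (\<lambda>x. 1, 0) (\<lambda>x. 1, 0)"
  shows "R (cs_power V y j n) (cs_power V y' j n)"
  using assms(1)
proof (induction j arbitrary: n)
  case 0
  then show ?case using assms(2) by (simp add: cs_slow)
next
  case (Suc j)
  then show ?case by (auto intro!: cs_mult)
qed

lemma cs_subst:
  assumes "\<And>i. i \<le> n \<Longrightarrow> R (y i) (y' i)" "R (\<lambda>x. 1, 0) (\<lambda>x. 1, 0)"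
    and "\<And>j k. R (y_coeff Q j k, 0) (y_coeff Q j k, 0)"
  shows "R (cs_subst V p Q y n) (cs_subst V p Q y' n)"
  unfolding cs_subst_def
proof (rule sum, clarify)
  fix j k
  show "R (eta_shift (p * k) (cs_mult V (cs_slow (y_coeff Q j k)) (cs_power V y j)) n)
          (eta_shift (p * k) (cs_mult V (cs_slow (y_coeff Q j k)) (cs_power V y' j)) n)"
    unfolding eta_shift_def using assms zero by (auto intro!: cs_mult cs_slow cs_power)
qed

end

lemma entry_relation_eq: "entry_relation V (=)"
  by standard auto

lemma sum_fun_apply: "(\<Sum>i\<in>I. F i) x = (\<Sum>i\<in>I. F i x)"
  by (induction I rule: infinite_finite_induct) auto

lemma fst_entry_mult:
  "fst (entry_mult V u v \<nu>) x = (if \<nu> = 0 then fst u x * fst v x else 0)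
     + asym_coeff V (snd v) \<nu> * (shift_S ^^ \<nu>) (fst u) x + asym_coeff V (snd u) \<nu> * (shift_S ^^ \<nu>) (fst v) x"
  by (cases u; cases v) (simp add: entry_mult_def slow_times_fast_def)

lemma snd_entry_mult:
  "snd (entry_mult V u v \<nu>) X = (if \<nu> = 0 then snd u X * snd v X else 0)
     + taylor_coeff (fst u) \<nu> * (shift_T V ^^ \<nu>) (snd v) X + taylor_coeff (fst v) \<nu> * (shift_T V ^^ \<nu>) (snd u) X"
  by (cases u; cases v) (simp add: entry_mult_def slow_times_fast_def)

text \<open>Deliberately not reflexive: \<open>entry_eq D V u u\<close> says that u belongs to the
  spaces. So the same facts about the operations yield closure of the spaces on the diagonal and
  congruence off it.\<close>

definition entry_eq ::
  "complex set \<Rightarrow> complex set \<Rightarrow> (complex \<Rightarrow> complex) \<times> (complex \<Rightarrow> complex) \<Rightarrow>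
   (complex \<Rightarrow> complex) \<times> (complex \<Rightarrow> complex) \<Rightarrow> bool" where
  "entry_eq D V u v \<longleftrightarrow> fst u holomorphic_on D \<and> fst v holomorphic_on D \<and>
     snd u \<in> fast_space V \<and> snd v \<in> fast_space V \<and>
     (\<forall>x\<in>D. fst u x = fst v x) \<and> (\<forall>X\<in>V. snd u X = snd v X)"

lemma entry_relation_entry_eq:
  assumes D: "open D" "0 \<in> D" and ne: "infinity_in V \<noteq> bot"
  shows "entry_relation V (entry_eq D V)"
proof
  show "entry_eq D V 0 0"
    using fast_space_zero[of V] by (simp add: entry_eq_def zero_fun_def)
next
  fix u u' v v' assume "entry_eq D V u u'" "entry_eq D V v v'"
  then show "entry_eq D V (u + v) (u' + v')"
    by (auto simp: entry_eq_def plus_fun_def intro!: holomorphic_intros fast_space_add)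
next
  have closed: "fst (entry_mult V u v \<nu>) holomorphic_on D \<and> snd (entry_mult V u v \<nu>) \<in> fast_space V"
    if "fst u holomorphic_on D" "fst v holomorphic_on D" "snd u \<in> fast_space V" "snd v \<in> fast_space V" for u v \<nu>
  proof
    show "fst (entry_mult V u v \<nu>) holomorphic_on D"
      unfolding fst_entry_mult[abs_def]
      by (cases "\<nu> = 0") (use that D in \<open>auto intro!: holomorphic_intros shift_S_power_holomorphic\<close>)
    show "snd (entry_mult V u v \<nu>) \<in> fast_space V"
      unfolding snd_entry_mult[abs_def]
      by (cases "\<nu> = 0") (use that ne in \<open>auto intro!: fast_space_add fast_space_mult fast_space_cmult
            shift_T_power_fast fast_space_zero\<close>)
  qed
  fix u u' v v' \<nu> assume eq: "entry_eq D V u u'" "entry_eq D V v v'"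
  have S: "(shift_S ^^ \<nu>) (fst u) x = (shift_S ^^ \<nu>) (fst u') x" "(shift_S ^^ \<nu>) (fst v) x = (shift_S ^^ \<nu>) (fst v') x"
    if "x \<in> D" for x
    using eq that by (auto simp: entry_eq_def intro!: shift_S_power_cong[OF D])
  have T: "(shift_T V ^^ \<nu>) (snd u) X = (shift_T V ^^ \<nu>) (snd u') X" "(shift_T V ^^ \<nu>) (snd v) X = (shift_T V ^^ \<nu>) (snd v') X"
    if "X \<in> V" for X
    using eq that by (auto simp: entry_eq_def intro!: shift_T_power_cong)
  have t: "taylor_coeff (fst u) \<nu> = taylor_coeff (fst u') \<nu>" "taylor_coeff (fst v) \<nu> = taylor_coeff (fst v') \<nu>"
    using eq by (auto simp: entry_eq_def intro!: taylor_coeff_cong[OF D])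
  have c: "asym_coeff V (snd u) = asym_coeff V (snd u')" "asym_coeff V (snd v) = asym_coeff V (snd v')"
    using eq by (auto simp: entry_eq_def intro!: asym_coeff_cong)
  show "entry_eq D V (entry_mult V u v \<nu>) (entry_mult V u' v' \<nu>)"
    using closed[of u v \<nu>] closed[of u' v' \<nu>] eq
    by (simp add: entry_eq_def fst_entry_mult snd_entry_mult S T t c)
qed

lemma shift_T_power_zero:
  assumes "infinity_in V \<noteq> bot"
  shows "(shift_T V ^^ n) (\<lambda>X. 0) = (\<lambda>X. 0)"
proof -
  have "asym_coeff V (\<lambda>X. 0) = (\<lambda>\<nu>. 0)"
    by (rule asym_coeff_eqI[OF assms has_asymptotics_zero])
  then show ?thesis
    by (induction n) (auto simp: shift_T_def)
qed

lemma entry_mult_zero: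
  assumes "infinity_in V \<noteq> bot"
  shows "entry_mult V 0 v \<nu> = 0"
proof -
  have "asym_coeff V (\<lambda>X. 0) = (\<lambda>\<nu>. 0)"
    by (rule asym_coeff_eqI[OF assms has_asymptotics_zero])
  then show ?thesis
    by (intro prod_eqI ext)
       (simp_all add: fst_entry_mult snd_entry_mult zero_fun_def shift_S_power_zero
         taylor_coeff_zero shift_T_power_zero[OF assms])
qed

lemma cs_mult_slow:
  assumes "infinity_in V \<noteq> bot"
  shows "cs_mult V (cs_slow a) y n = (\<Sum>j\<le>n. entry_mult V (a, 0) (y j) (n - j))"
proof -
  have "(\<Sum>j\<le>n - i. entry_mult V (cs_slow a i) (y j) (n - i - j)) = 0" if "i \<noteq> 0" for i
    using that by (intro sum.neutral) (simp add: cs_slow_def entry_mult_zero[OF assms])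
  then have "cs_mult V (cs_slow a) y n = (\<Sum>i\<in>{0}. \<Sum>j\<le>n - i. entry_mult V (cs_slow a i) (y j) (n - i - j))"
    unfolding cs_mult_def by (intro sum.mono_neutral_right) auto
  then show ?thesis
    by (simp add: cs_slow_def)
qed

section \<open>Taylor coefficients depending on a parameter\<close>

lemma holomorphic2_imp_continuous_on:
  assumes "holomorphic2_on q U"
  shows "continuous_on U q"
proof (intro continuous_at_imp_continuous_on ballI)
  fix z assume "z \<in> U"
  then show "isCont q z"
    using assms has_derivative_continuous unfolding holomorphic2_on_def by blast
qed

lemma holomorphic2_imp_holomorphic_on:
  assumes q: "holomorphic2_on q (A \<times> B)"
  shows "y \<in> B \<Longrightarrow> (\<lambda>x. q (x, y)) holomorphic_on A" and "x \<in> A \<Longrightarrow> (\<lambda>y. q (x, y)) holomorphic_on B"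
proof -
  have q': "\<exists>a b. (q has_derivative (\<lambda>(h, k). a * h + b * k)) (at (x, y))" if "x \<in> A" "y \<in> B" for x y
    using q that unfolding holomorphic2_on_def by blast
  show "(\<lambda>x. q (x, y)) holomorphic_on A" if y: "y \<in> B"
  proof (rule holomorphic_onI)
    fix x assume "x \<in> A"
    then obtain a b where "(q has_derivative (\<lambda>(h, k). a * h + b * k)) (at (x, y))"
      using q' y by blast
    then have "((\<lambda>x. q (x, y)) has_derivative (\<lambda>h. (\<lambda>(h, k). a * h + b * k) (h, 0))) (at x)"
      by (rule has_derivative_compose[rotated]) (auto intro!: derivative_eq_intros)
    then have "((\<lambda>x. q (x, y)) has_field_derivative a) (at x)"
      by (simp add: has_field_derivative_def)
    then show "(\<lambda>x. q (x, y)) field_differentiable at x within A"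
      by (meson field_differentiable_def has_field_derivative_at_within)
  qed
  show "(\<lambda>y. q (x, y)) holomorphic_on B" if x: "x \<in> A"
  proof (rule holomorphic_onI)
    fix y assume "y \<in> B"
    then obtain a b where "(q has_derivative (\<lambda>(h, k). a * h + b * k)) (at (x, y))"
      using q' x by blast
    then have "((\<lambda>y. q (x, y)) has_derivative (\<lambda>k. (\<lambda>(h, k). a * h + b * k) (0, k))) (at y)"
      by (rule has_derivative_compose[rotated]) (auto intro!: derivative_eq_intros)
    then have "((\<lambda>y. q (x, y)) has_field_derivative b) (at y)"
      by (simp add: has_field_derivative_def)
    then show "(\<lambda>y. q (x, y)) field_differentiable at y within B"
      by (meson field_differentiable_def has_field_derivative_at_within)
  qed
qed

lemma continuous_on_circlepath_integral:
  assumes f: "continuous_on (A \<times> sphere 0 s) (\<lambda>(x, u). f x u)" and s: "0 \<le> s"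
  shows "continuous_on A (\<lambda>x. contour_integral (circlepath 0 s) (f x))"
proof -
  have "contour_integral (circlepath 0 s) (f x) = integral (cbox 0 1) (\<lambda>t. f x (circlepath 0 s t)
      * (2 * pi * \<i> * s * exp (2 * of_real pi * \<i> * t)))" for x
    unfolding contour_integral_integral
    by (simp, rule integral_cong) (simp add: vector_derivative_circlepath)
  moreover have "continuous_on A (\<lambda>x. integral (cbox 0 1) (\<lambda>t. f x (circlepath 0 s t)
      * (2 * pi * \<i> * s * exp (2 * of_real pi * \<i> * t))))"
  proof (rule integral_continuous_on_param)
    have "continuous_on (A \<times> cbox 0 1) (\<lambda>z. (\<lambda>(x, u). f x u) (fst z, circlepath 0 s (snd z)))"
    proof (rule continuous_on_compose2[OF f])
      show "continuous_on (A \<times> cbox 0 1) (\<lambda>z. (fst z, circlepath 0 s (snd z)))"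
        unfolding circlepath by (intro continuous_intros)
      show "(\<lambda>z. (fst z, circlepath 0 s (snd z))) ` (A \<times> cbox 0 1) \<subseteq> A \<times> sphere 0 s"
        using s by (auto simp: circlepath norm_mult)
    qed
    then show "continuous_on (A \<times> cbox 0 1) (\<lambda>(x, t). f x (circlepath 0 s t)
      * (2 * pi * \<i> * s * exp (2 * of_real pi * \<i> * t)))"
      by (auto simp: case_prod_beta' intro!: continuous_intros)
  qed
  ultimately show ?thesis
    by simp
qed

text \<open>The Cauchy formula in \<open>x\<close> can be interchanged with the integral.\<close>

lemma holomorphic_on_circlepath_integral:
  assumes cont: "continuous_on (ball 0 r \<times> sphere 0 s) (\<lambda>(x, u). f x u)" and s: "0 < s"
    and holo: "\<And>u. u \<in> sphere 0 s \<Longrightarrow> (\<lambda>x. f x u) holomorphic_on ball 0 r"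
  shows "(\<lambda>x. contour_integral (circlepath 0 s) (f x)) holomorphic_on ball 0 r"
proof (rule holomorphic_onI)
  fix x0 :: complex assume x0: "x0 \<in> ball 0 r"
  define F where "F = (\<lambda>x. contour_integral (circlepath 0 s) (f x))"
  obtain \<rho> where \<rho>: "norm x0 < \<rho>" "\<rho> < r"
    using x0 dense[of "norm x0" r] by auto
  then have "0 < \<rho>"
    using norm_ge_zero[of x0] by linarith
  have sub: "sphere 0 \<rho> \<subseteq> ball 0 r" "cball 0 \<rho> \<subseteq> ball 0 r"
    using \<rho> by auto
  have F_cont: "continuous_on (sphere 0 \<rho>) F"
    unfolding F_def using cont s sub
    by (intro continuous_on_circlepath_integral) (auto intro: continuous_on_subset)
  have Cauchy: "((\<lambda>\<xi>. F \<xi> / (\<xi> - x) ^ 1) has_contour_integral 2 * pi * \<i> * F x) (circlepath 0 \<rho>)"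
    if x: "x \<in> ball 0 \<rho>" for x
  proof -
    have ne: "\<xi> \<noteq> x" if "\<xi> \<in> sphere 0 \<rho>" for \<xi>
      using x that by auto
    have cont1: "continuous_on (sphere 0 \<rho> \<times> sphere 0 s) (\<lambda>(\<xi>, u). f \<xi> u / (\<xi> - x))"
      using continuous_on_subset[OF cont, of "sphere 0 \<rho> \<times> sphere 0 s"] sub ne
      by (auto simp: case_prod_beta' intro!: continuous_intros)
    have "contour_integral (circlepath 0 \<rho>) (\<lambda>\<xi>. F \<xi> / (\<xi> - x))
        = contour_integral (circlepath 0 \<rho>) (\<lambda>\<xi>. contour_integral (circlepath 0 s) (\<lambda>u. f \<xi> u / (\<xi> - x)))"
    proof (rule contour_integral_cong[OF refl])
      fix \<xi> assume "\<xi> \<in> path_image (circlepath 0 \<rho>)"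
      then have "\<xi> \<in> sphere 0 \<rho>"
        using \<open>0 < \<rho>\<close> by simp
      then have "continuous_on (sphere 0 s) (f \<xi>)"
        using sub by (intro continuous_on_compose2[OF cont, of _ "\<lambda>u. (\<xi>, u)", simplified] continuous_intros) auto
      then have "f \<xi> contour_integrable_on circlepath 0 s"
        using s by (intro contour_integrable_continuous_circlepath) simp
      from contour_integral_div[OF this]
      show "F \<xi> / (\<xi> - x) = contour_integral (circlepath 0 s) (\<lambda>u. f \<xi> u / (\<xi> - x))"
        by (simp add: F_def)
    qed
    also have "\<dots> = contour_integral (circlepath 0 s) (\<lambda>u. contour_integral (circlepath 0 \<rho>) (\<lambda>\<xi>. f \<xi> u / (\<xi> - x)))"
      using cont1 \<open>0 < \<rho>\<close> s
      by (intro contour_integral_swap) (auto simp: vector_derivative_circlepath intro!: continuous_intros)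
    also have "\<dots> = contour_integral (circlepath 0 s) (\<lambda>u. 2 * pi * \<i> * f x u)"
    proof (rule contour_integral_cong[OF refl])
      fix u assume "u \<in> path_image (circlepath 0 s)"
      then have "(\<lambda>x. f x u) holomorphic_on ball 0 r"
        using s holo by simp
      then have "continuous_on (cball 0 \<rho>) (\<lambda>x. f x u)" "(\<lambda>x. f x u) holomorphic_on ball 0 \<rho>"
        using sub ball_subset_cball[of 0 \<rho>]
        by (meson holomorphic_on_imp_continuous_on holomorphic_on_subset subset_trans)+
      from Cauchy_integral_circlepath[OF this, of x] x
      show "contour_integral (circlepath 0 \<rho>) (\<lambda>\<xi>. f \<xi> u / (\<xi> - x)) = 2 * pi * \<i> * f x u"
        by (intro contour_integral_unique) simp
    qed
    also have "\<dots> = 2 * pi * \<i> * F x"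
    proof -
      have "continuous_on (sphere 0 s) (f x)"
        using sub x by (intro continuous_on_compose2[OF cont, of _ "\<lambda>u. (x, u)", simplified] continuous_intros) auto
      then have "f x contour_integrable_on circlepath 0 s"
        using s by (intro contour_integrable_continuous_circlepath) simp
      then show ?thesis
        unfolding F_def by (rule contour_integral_lmul)
    qed
    finally have "contour_integral (circlepath 0 \<rho>) (\<lambda>\<xi>. F \<xi> / (\<xi> - x)) = 2 * pi * \<i> * F x" .
    moreover have "(\<lambda>\<xi>. F \<xi> / (\<xi> - x)) contour_integrable_on circlepath 0 \<rho>"
      using F_cont \<open>0 < \<rho>\<close> ne
      by (intro contour_integrable_continuous_circlepath) (auto intro!: continuous_intros)
    ultimately show ?thesis
      using has_contour_integral_integral by fastforce
  qed
  \<comment> \<open>At this point F is only known to be continuous. Being reproduced by its Cauchy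
    integral over |\<xi>| = \<rho> makes it differentiable at x0.\<close>
  have "((\<lambda>x. 2 * pi * \<i> * F x) has_field_derivative
      (of_nat 1 * contour_integral (circlepath 0 \<rho>) (\<lambda>\<xi>. F \<xi> / (\<xi> - x0) ^ Suc 1))) (at x0)"
    by (rule Cauchy_next_derivative_circlepath(2)[OF _ Cauchy]) (use F_cont \<open>0 < \<rho>\<close> \<rho> in auto)
  then have "((\<lambda>x. 2 * pi * \<i> * F x / (2 * pi * \<i>)) has_field_derivative
      (of_nat 1 * contour_integral (circlepath 0 \<rho>) (\<lambda>\<xi>. F \<xi> / (\<xi> - x0) ^ Suc 1)) / (2 * pi * \<i>)) (at x0)"
    by (rule DERIV_cdivide)
  then show "(\<lambda>x. contour_integral (circlepath 0 s) (f x)) field_differentiable at x0 within ball 0 r"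
    unfolding F_def field_differentiable_def by (auto intro: has_field_derivative_at_within)
qed

text \<open>Cauchy's formula on |u| = s/2, a circle that does not depend on x, writes the
  coefficient as an integral of functions holomorphic in x. This makes the p_jk admissible as slow
  functions.\<close>

lemma taylor_coeff_holomorphic:
  assumes q: "holomorphic2_on q (ball 0 r \<times> ball 0 s)" and s: "0 < s"
  shows "(\<lambda>x. taylor_coeff (\<lambda>y. q (x, y)) j) holomorphic_on ball 0 r"
proof -
  define F where "F = (\<lambda>x. contour_integral (circlepath 0 (s / 2)) (\<lambda>u. q (x, u) / u ^ Suc j))"
  have sub: "cball 0 (s / 2) \<subseteq> ball 0 s" "ball 0 (s / 2) \<subseteq> ball 0 s" "sphere 0 (s / 2) \<subseteq> ball 0 s"
    using s by auto
  have "F holomorphic_on ball 0 r"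
    unfolding F_def
  proof (rule holomorphic_on_circlepath_integral)
    have "continuous_on (ball 0 r \<times> sphere 0 (s / 2)) q"
      using holomorphic2_imp_continuous_on[OF q] sub by (auto intro: continuous_on_subset)
    then show "continuous_on (ball 0 r \<times> sphere 0 (s / 2)) (\<lambda>(x, u). q (x, u) / u ^ Suc j)"
      using s by (auto simp: case_prod_beta' simp del: power_Suc intro!: continuous_intros)
    show "(\<lambda>x. q (x, u) / u ^ Suc j) holomorphic_on ball 0 r" if "u \<in> sphere 0 (s / 2)" for u
      using that sub s by (intro holomorphic_intros holomorphic2_imp_holomorphic_on[OF q]) auto
  qed (use s in auto)
  then have "(\<lambda>x. F x / (2 * pi * \<i>)) holomorphic_on ball 0 r"
    by (intro holomorphic_intros) auto
  moreover have "F x / (2 * pi * \<i>) = taylor_coeff (\<lambda>y. q (x, y)) j" if "x \<in> ball 0 r" for x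
  proof -
    have "(\<lambda>y. q (x, y)) holomorphic_on ball 0 s"
      using that by (rule holomorphic2_imp_holomorphic_on[OF q])
    then have "continuous_on (cball 0 (s / 2)) (\<lambda>y. q (x, y))" "(\<lambda>y. q (x, y)) holomorphic_on ball 0 (s / 2)"
      using sub by (meson holomorphic_on_imp_continuous_on holomorphic_on_subset)+
    from Cauchy_higher_derivative_integral_circlepath(2)[OF this, of 0 j] s
    have "(deriv ^^ j) (\<lambda>y. q (x, y)) 0 = fact j / (2 * pi * \<i>) * F x"
      by (simp add: F_def)
    then show ?thesis
      by (simp add: taylor_coeff_def)
  qed
  ultimately show ?thesis
    by (rule holomorphic_transform)
qed

section \<open>The formal solution\<close>

text \<open>As S^\<nu> x^k = x^(k-\<nu>) for \<nu> <= k, the fast part of order j contributes to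
  order n the single monomial of degree l = k-(n-j); for j = n its coefficient has index 0 and
  vanishes. The monomial has one nonzero Taylor coefficient, so the fast part reduces to a single
  T^k.\<close>

lemma cs_mult_monomial:
  assumes ne: "infinity_in V \<noteq> bot" and y: "\<And>n. snd (y n) \<in> fast_space V"
  shows "fst (cs_mult V (cs_slow (\<lambda>x. c * x ^ k)) y n) x = c * x ^ k * fst (y n) x
      + (\<Sum>l<k. c * (if k - l \<le> n then asym_coeff V (snd (y (n - (k - l)))) (k - l) else 0) * x ^ l)"
    and "snd (cs_mult V (cs_slow (\<lambda>x. c * x ^ k)) y n) X
      = (if k \<le> n then c * (shift_T V ^^ k) (snd (y (n - k))) X else 0)"
proof -
  have z: "asym_coeff V (\<lambda>X. 0) = (\<lambda>\<nu>. 0)"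
    by (rule asym_coeff_eqI[OF ne has_asymptotics_zero])
  have "fst (cs_mult V (cs_slow (\<lambda>x. c * x ^ k)) y n) x =
      (\<Sum>j\<le>n. (if j = n then c * x ^ k * fst (y j) x else 0)
        + asym_coeff V (snd (y j)) (n - j) * (if n - j \<le> k then c * x ^ (k - (n - j)) else 0))"
    unfolding cs_mult_slow[OF ne] fst_sum sum_fun_apply fst_entry_mult
    by (rule sum.cong) (auto simp: zero_fun_def z shift_S_power_monomial)
  also have "\<dots> = c * x ^ k * fst (y n) x
      + (\<Sum>j\<le>n. asym_coeff V (snd (y j)) (n - j) * (if n - j \<le> k then c * x ^ (k - (n - j)) else 0))"
    by (simp add: sum.distrib)
  also have "(\<Sum>j\<le>n. asym_coeff V (snd (y j)) (n - j) * (if n - j \<le> k then c * x ^ (k - (n - j)) else 0))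
      = (\<Sum>j | j < n \<and> n - j \<le> k. c * asym_coeff V (snd (y j)) (n - j) * x ^ (k - (n - j)))"
    by (rule sum.mono_neutral_cong_right) (auto simp: asym_coeff_0[OF ne y])
  also have "\<dots> = (\<Sum>l | l < k \<and> k - l \<le> n. c * asym_coeff V (snd (y (n - (k - l)))) (k - l) * x ^ l)"
    by (rule sum.reindex_bij_witness[of _ "\<lambda>l. n - (k - l)" "\<lambda>j. k - (n - j)"]) auto
  also have "\<dots> = (\<Sum>l<k. c * (if k - l \<le> n then asym_coeff V (snd (y (n - (k - l)))) (k - l) else 0) * x ^ l)"
    by (rule sum.mono_neutral_cong_left) auto
  finally show "fst (cs_mult V (cs_slow (\<lambda>x. c * x ^ k)) y n) x = c * x ^ k * fst (y n) x
      + (\<Sum>l<k. c * (if k - l \<le> n then asym_coeff V (snd (y (n - (k - l)))) (k - l) else 0) * x ^ l)" .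
  have "snd (cs_mult V (cs_slow (\<lambda>x. c * x ^ k)) y n) X =
      (\<Sum>j\<le>n. if n - j = k then c * (shift_T V ^^ k) (snd (y j)) X else 0)"
    unfolding cs_mult_slow[OF ne] snd_sum sum_fun_apply snd_entry_mult
    by (rule sum.cong) (auto simp: zero_fun_def shift_T_power_zero[OF ne] taylor_coeff_monomial)
  also have "\<dots> = (\<Sum>j | j \<le> n \<and> n - j = k. c * (shift_T V ^^ k) (snd (y j)) X)"
    by (rule sum.mono_neutral_cong_right) auto
  also have "{j. j \<le> n \<and> n - j = k} = (if k \<le> n then {n - k} else {})"
    by auto
  finally show "snd (cs_mult V (cs_slow (\<lambda>x. c * x ^ k)) y n) X
      = (if k \<le> n then c * (shift_T V ^^ k) (snd (y (n - k))) X else 0)"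
    by simp
qed

text \<open>At order \<open>n\<close> the slow part of the equation reads
  \<open>residual n = p x\<^sup>p\<^sup>-\<^sup>1 a\<^sub>n + p \<Sum> fast_coeff n l x\<^sup>l\<close>; the fast part at order \<open>n + p - 1\<close> reads
  \<open>g\<^sub>n' = p T\<^sup>p\<^sup>-\<^sup>1 g\<^sub>n + forcing n\<close>.\<close>

definition residual ::
  "complex set \<Rightarrow> nat \<Rightarrow> (nat \<Rightarrow> complex \<times> complex \<Rightarrow> complex) \<Rightarrow> combined_series \<Rightarrow> nat \<Rightarrow> complex \<Rightarrow> complex"
  where
  "residual V p Q y n =
     (if n < p then (\<lambda>x. 0) else (\<lambda>x. deriv (fst (y (n - p))) x - fst (cs_subst V p Q y (n - p)) x))"

definition forcing ::
  "complex set \<Rightarrow> nat \<Rightarrow> (nat \<Rightarrow> complex \<times> complex \<Rightarrow> complex) \<Rightarrow> combined_series \<Rightarrow> nat \<Rightarrow> complex \<Rightarrow> complex"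
  where
  "forcing V p Q y n = (if n = 0 then (\<lambda>X. 0) else snd (cs_subst V p Q y (n - 1)))"

definition fast_coeff :: "complex set \<Rightarrow> nat \<Rightarrow> combined_series \<Rightarrow> nat \<Rightarrow> nat \<Rightarrow> complex" where
  "fast_coeff V p y n l =
     (if p - 1 - l \<le> n then asym_coeff V (snd (y (n - (p - 1 - l)))) (p - 1 - l) else 0)"

text \<open>Both g_n' and T^(p-1) g_n sit at order n+p-1, hence the shift of the fast equations by
  p-1; those of lower order read 0 = 0. The substituted series enters there with index n-1, whence
  the case n = 0 in \<open>forcing\<close>.\<close>

lemma formal_solution_iff:
  assumes ne: "infinity_in V \<noteq> bot" and y: "\<And>n. snd (y n) \<in> fast_space V" and p: "0 < p"
  shows "formal_solution D V p Q y \<longleftrightarrow>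
    (\<forall>n. \<forall>x\<in>D. residual V p Q y n x = of_nat p * x ^ (p - 1) * fst (y n) x
       + (\<Sum>l<p - 1. of_nat p * fast_coeff V p y n l * x ^ l)) \<and>
    (\<forall>n. \<forall>X\<in>V. deriv (snd (y n)) X = of_nat p * (shift_T V ^^ (p - 1)) (snd (y n)) X + forcing V p Q y n X)"
proof -
  let ?rhs = "\<lambda>n. (cs_mult V (cs_slow (\<lambda>x. of_nat p * x ^ (p - 1))) y + eta_shift p (cs_subst V p Q y)) n"
  have fst_l: "fst (eta_pow_deriv p y n) x = (if n < p then 0 else deriv (fst (y (n - p))) x)" for n x
    by (simp add: eta_pow_deriv_def eta_shift_def)
  have snd_l: "snd (eta_pow_deriv p y n) X = (if n < p - 1 then 0 else deriv (snd (y (n - (p - 1)))) X)" for n X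
    by (simp add: eta_pow_deriv_def eta_shift_def)
  have fst_r: "fst (?rhs n) x = of_nat p * x ^ (p - 1) * fst (y n) x
       + (\<Sum>l<p - 1. of_nat p * fast_coeff V p y n l * x ^ l) + (if n < p then 0 else fst (cs_subst V p Q y (n - p)) x)"
    for n x
    by (simp add: eta_shift_def fast_coeff_def cs_mult_monomial[OF ne y] del: One_nat_def)
  have snd_r: "snd (?rhs n) X = (if p - 1 \<le> n then of_nat p * (shift_T V ^^ (p - 1)) (snd (y (n - (p - 1)))) X else 0)
       + (if n < p then 0 else snd (cs_subst V p Q y (n - p)) X)" for n X
    by (simp add: eta_shift_def cs_mult_monomial[OF ne y] del: One_nat_def)
  have slow: "fst (eta_pow_deriv p y n) x = fst (?rhs n) x \<longleftrightarrow>
      residual V p Q y n x = of_nat p * x ^ (p - 1) * fst (y n) x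
       + (\<Sum>l<p - 1. of_nat p * fast_coeff V p y n l * x ^ l)" for n x
    unfolding fst_l fst_r residual_def by (simp add: diff_eq_eq)
  have fast: "snd (eta_pow_deriv p y (n + (p - 1))) X = snd (?rhs (n + (p - 1))) X \<longleftrightarrow>
      deriv (snd (y n)) X = of_nat p * (shift_T V ^^ (p - 1)) (snd (y n)) X + forcing V p Q y n X" for n X
  proof -
    have "n + (p - 1) < p \<longleftrightarrow> n = 0" "n + (p - 1) - p = n - 1" "\<not> n + (p - 1) < p - 1" "n + (p - 1) - (p - 1) = n"
      "p - 1 \<le> n + (p - 1)"
      using p by auto
    then show ?thesis
      unfolding snd_l snd_r forcing_def by (simp del: One_nat_def)
  qed
  have fast_low: "snd (eta_pow_deriv p y n) X = snd (?rhs n) X" if "n < p - 1" for n X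
    using that unfolding snd_l snd_r by simp
  have "(\<forall>n. \<forall>X\<in>V. snd (eta_pow_deriv p y n) X = snd (?rhs n) X) \<longleftrightarrow>
      (\<forall>n. \<forall>X\<in>V. snd (eta_pow_deriv p y (n + (p - 1))) X = snd (?rhs (n + (p - 1))) X)"
    using fast_low by (metis le_add_diff_inverse2 not_le)
  then show ?thesis
    unfolding formal_solution_def cs_eq_def fast slow[symmetric] by blast
qed

lemma cs_subst_cong:
  assumes "\<And>i. i \<le> n \<Longrightarrow> y i = y' i"
  shows "cs_subst V p Q y n = cs_subst V p Q y' n"
  by (rule entry_relation.cs_subst[OF entry_relation_eq]) (use assms in auto)

text \<open>Causality of the recursion. The bound is i + p <= n and not merely i < n, because the
  slow equations of all orders below n+p must be available when only the entries below n are
  known.\<close>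

lemma residual_cong:
  assumes "\<And>i. i + p \<le> n \<Longrightarrow> y i = y' i"
  shows "residual V p Q y n = residual V p Q y' n"
proof (cases "n < p")
  case False
  then have "cs_subst V p Q y (n - p) = cs_subst V p Q y' (n - p)" "y (n - p) = y' (n - p)"
    using assms by (auto intro!: cs_subst_cong)
  then show ?thesis
    by (simp add: residual_def)
qed (simp add: residual_def)

lemma forcing_cong:
  assumes "\<And>i. i < n \<Longrightarrow> y i = y' i"
  shows "forcing V p Q y n = forcing V p Q y' n"
  using assms cs_subst_cong[of "n - 1" y y' V p Q] by (auto simp: forcing_def)

lemma fast_coeff_cong:
  assumes "\<And>i. i < n \<Longrightarrow> y i = y' i" "l < p - 1"
  shows "fast_coeff V p y n l = fast_coeff V p y' n l"
  using assms by (auto simp: fast_coeff_def)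

section \<open>Uniqueness and existence by induction on the order\<close>

context quasi_sector_equation begin

text \<open>If the entries below n agree, so do the residuals of all orders below n+p. The slow
  equations of these orders then determine the slow part of order n and, looking p-1 orders ahead,
  the first p-1 coefficients of the fast part. The fast parts of order n therefore differ by a
  bounded homogeneous solution.\<close>

lemma formal_solution_unique:
  assumes r: "0 < r" and Q: "\<And>j k. y_coeff Q j k holomorphic_on ball 0 r"
    and y: "y \<in> cs_space (ball 0 r) V" "formal_solution (ball 0 r) V p Q y"
    and z: "z \<in> cs_space (ball 0 r) V" "formal_solution (ball 0 r) V p Q z"
  shows "cs_eq (ball 0 r) V z y"
proof -
  define D where "D = ball (0::complex) r"
  have D: "open D" "0 \<in> D"
    using r by (auto simp: D_def)
  have p: "0 < p"
    using p_ge_2 by auto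
  interpret entry_relation V "entry_eq D V"
    by (rule entry_relation_entry_eq[OF D infinity_in_V])
  have y_in: "fst (y n) holomorphic_on D" "snd (y n) \<in> fast_space V" for n
    using y by (auto simp: cs_space_def D_def)
  have z_in: "fst (z n) holomorphic_on D" "snd (z n) \<in> fast_space V" for n
    using z by (auto simp: cs_space_def D_def)
  note y_eq = y(2)[unfolded formal_solution_iff[OF infinity_in_V y_in(2) p], folded D_def]
  note y_slow = y_eq[THEN conjunct1, rule_format] and y_fast = y_eq[THEN conjunct2, rule_format]
  note z_eq = z(2)[unfolded formal_solution_iff[OF infinity_in_V z_in(2) p], folded D_def]
  note z_slow = z_eq[THEN conjunct1, rule_format] and z_fast = z_eq[THEN conjunct2, rule_format]
  have const: "entry_eq D V (\<lambda>x. 1, 0) (\<lambda>x. 1, 0)" "entry_eq D V (y_coeff Q j k, 0) (y_coeff Q j k, 0)" for j k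
    using Q fast_space_zero[of V] by (auto simp: entry_eq_def zero_fun_def D_def)
  have "entry_eq D V (z n) (y n)" for n
  proof (induction n rule: less_induct)
    case (less n)
    have subst: "entry_eq D V (cs_subst V p Q z i) (cs_subst V p Q y i)" if "i < n" for i
      using less that by (intro cs_subst const) auto
    have res: "residual V p Q z m x = residual V p Q y m x" if "m < n + p" "x \<in> D" for m x
    proof (cases "m < p")
      case False
      then have i: "m - p < n"
        using that by auto
      have "deriv (fst (z (m - p))) x = deriv (fst (y (m - p))) x"
        using less[OF i] that(2) D by (intro deriv_cong_ev) (auto simp: entry_eq_def eventually_nhds)
      then show ?thesis
        using False subst[OF i] that(2) by (simp add: residual_def entry_eq_def)
    qed (simp add: residual_def)
    have key: "\<And>l. l < p - 1 \<Longrightarrow> fast_coeff V p z m l = fast_coeff V p y m l"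
        "\<And>x. x \<in> D \<Longrightarrow> fst (z m) x = fst (y m) x" if "m < n + p" for m
    proof -
      have A: "(\<lambda>x. of_nat p * (fst (z m) x - fst (y m) x)) holomorphic_on ball 0 r"
        using y_in z_in by (auto simp: D_def intro!: holomorphic_intros)
      have "(\<Sum>l<p - 1. of_nat p * (fast_coeff V p z m l - fast_coeff V p y m l) * x ^ l)
          + x ^ (p - 1) * (of_nat p * (fst (z m) x - fst (y m) x)) = 0" if "x \<in> ball 0 r" for x
      proof -
        have "x \<in> D"
          using that by (simp add: D_def)
        then have "of_nat p * x ^ (p - 1) * fst (z m) x + (\<Sum>l<p - 1. of_nat p * fast_coeff V p z m l * x ^ l)
           = of_nat p * x ^ (p - 1) * fst (y m) x + (\<Sum>l<p - 1. of_nat p * fast_coeff V p y m l * x ^ l)"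
          using y_slow[of x m] z_slow[of x m] res[OF \<open>m < n + p\<close>] by simp
        then show ?thesis
          by (simp add: algebra_simps sum_subtractf)
      qed
      note zero = polynomial_plus_remainder_zero[OF A r this]
      show "fast_coeff V p z m l = fast_coeff V p y m l" if "l < p - 1" for l
        using zero(1)[OF _ that] p by simp
      show "fst (z m) x = fst (y m) x" if "x \<in> D" for x
        using zero(2)[of x] that p by (simp add: D_def)
    qed
    \<comment> \<open>The coefficient \<nu> of the fast part of order n is found at order n+\<nu>,
      in the monomial of degree p-1-\<nu>.\<close>
    have coeff: "asym_coeff V (snd (z n)) \<nu> = asym_coeff V (snd (y n)) \<nu>" if "\<nu> \<in> {1..p - 1}" for \<nu>
    proof -
      have "p - 1 - (p - 1 - \<nu>) = \<nu>" "p - 1 - \<nu> < p - 1" "n + \<nu> < n + p"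
        using that by auto
      then show ?thesis
        using key(1)[of "n + \<nu>" "p - 1 - \<nu>"] by (simp add: fast_coeff_def del: One_nat_def)
    qed
    define d where "d = (\<lambda>X. snd (z n) X - snd (y n) X)"
    have "d X = 0" if "X \<in> V" for X
    proof (rule bounded_homogeneous_solution_zero[OF _ _ that])
      show "bounded (d ` V)"
        unfolding d_def using y_in z_in by (intro bounded_minus_comp) (auto simp: fast_space_def)
      fix X assume X: "X \<in> V"
      have der: "(g has_field_derivative deriv g X) (at X)" if "g \<in> fast_space V" for g
        using that holomorphic_derivI[OF _ open_V X] by (auto simp: fast_space_def)
      have "forcing V p Q z n X = forcing V p Q y n X"
        using subst[of "n - 1"] X by (cases "n = 0") (auto simp: forcing_def entry_eq_def)
      then have "deriv (snd (z n)) X - deriv (snd (y n)) X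
          = of_nat p * ((shift_T V ^^ (p - 1)) (snd (z n)) X - (shift_T V ^^ (p - 1)) (snd (y n)) X)"
        using y_eq z_eq X by (simp add: right_diff_distrib)
      also have "(\<Sum>\<nu>=1..p - 1. asym_coeff V (snd (z n)) \<nu> * X ^ (p - 1 - \<nu>))
          = (\<Sum>\<nu>=1..p - 1. asym_coeff V (snd (y n)) \<nu> * X ^ (p - 1 - \<nu>))"
        by (intro sum.cong refl) (simp only: coeff)
      then have "(shift_T V ^^ (p - 1)) (snd (z n)) X - (shift_T V ^^ (p - 1)) (snd (y n)) X = X ^ (p - 1) * d X"
        by (simp only: shift_T_power_eq[OF infinity_in_V] y_in z_in d_def) (simp add: right_diff_distrib)
      finally have "deriv (snd (z n)) X - deriv (snd (y n)) X = of_nat p * X ^ (p - 1) * d X"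
        by (simp add: mult.assoc)
      then show "(d has_field_derivative of_nat p * X ^ (p - 1) * d X) (at X)"
        using DERIV_diff[OF der[OF z_in(2)[of n]] der[OF y_in(2)[of n]]] by (simp add: d_def)
    qed
    then show ?case
      using key(2)[of n] p y_in z_in by (auto simp: entry_eq_def d_def)
  qed
  then show ?thesis
    by (auto simp: cs_eq_def entry_eq_def D_def)
qed

text \<open>When the slow equation of order n is reached, the fast coefficients in it are already
  fixed, so its solvability must have been arranged before. Each step therefore chooses its fast
  part with a view to the slow equations of orders n+1, ..., n+p-1.\<close>

lemma ex_formal_solution:
  assumes r: "0 < r" and Q: "\<And>j k. y_coeff Q j k holomorphic_on ball 0 r"
  shows "\<exists>y\<in>eta_cs_space (ball 0 r) V. formal_solution (ball 0 r) V p Q y"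
proof -
  define D where "D = ball (0::complex) r"
  have D: "open D" "0 \<in> D"
    using r by (auto simp: D_def)
  have p: "0 < p"
    using p_ge_2 by auto
  interpret entry_relation V "entry_eq D V"
    by (rule entry_relation_entry_eq[OF D infinity_in_V])
  have const: "entry_eq D V (\<lambda>x. 1, 0) (\<lambda>x. 1, 0)" "entry_eq D V (y_coeff Q j k, 0) (y_coeff Q j k, 0)" for j k
    using Q fast_space_zero[of V] by (auto simp: entry_eq_def zero_fun_def D_def)
  \<comment> \<open>Replacing the entries from n on by 0 lets a step depend on earlier entries only,
    as the recursion requires. By causality the truncation changes none of the quantities in
    use.\<close>
  define tr :: "combined_series \<Rightarrow> nat \<Rightarrow> combined_series" where "tr = (\<lambda>f n i. if i < n then f i else 0)"
  \<comment> \<open>The clause u = 0 at order 0 puts the solution into \<open>eta_cs_space\<close>.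
    The clause on \<open>asym_coeff\<close> is the provision for the slow equations of orders
    n+\<nu>; the last two are the equations of order n.\<close>
  define step where "step = (\<lambda>f n u. (n = 0 \<longrightarrow> u = 0) \<and> fst u holomorphic_on D \<and> snd u \<in> fast_space V \<and>
    (\<forall>\<nu>. 0 < \<nu> \<and> \<nu> < p \<longrightarrow>
       of_nat p * asym_coeff V (snd u) \<nu> = (shift_S ^^ (p - 1 - \<nu>)) (residual V p Q (tr f n) (n + \<nu>)) 0) \<and>
    (\<forall>x\<in>D. residual V p Q (tr f n) n x = of_nat p * x ^ (p - 1) * fst u x
       + (\<Sum>l<p - 1. of_nat p * fast_coeff V p (tr f n) n l * x ^ l)) \<and>
    (\<forall>X\<in>V. deriv (snd u) X = of_nat p * (shift_T V ^^ (p - 1)) (snd u) X + forcing V p Q (tr f n) n X))"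
  have "\<exists>y. \<forall>n. step y n (y n)"
  proof (rule dependent_wellorder_choice)
    fix u and f g :: combined_series and n
    assume "\<And>i. i < n \<Longrightarrow> f i = g i"
    then have "tr f n = tr g n"
      by (auto simp: tr_def)
    then show "step f n u = step g n u"
      by (simp add: step_def)
  next
    fix n f assume IH: "\<And>m. m < n \<Longrightarrow> step f m (f m)"
    show "\<exists>u. step f n u"
    proof (cases "n = 0")
      case True
      \<comment> \<open>All residuals involved have order below p and vanish, and so does the
        forcing at order 0; the zero entry meets every clause.\<close>
      have "step f n 0"
        unfolding step_def using True fast_space_zero[of V] p
        by (auto simp: zero_fun_def residual_def forcing_def fast_coeff_def shift_S_power_zero
            shift_T_power_zero[OF infinity_in_V] asym_coeff_eqI[OF infinity_in_V has_asymptotics_zero] intro!: sum.neutral)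
      then show ?thesis ..
    next
      case False
      define y where "y = tr f n"
      have y_in: "entry_eq D V (y i) (y i)" for i
        using IH zero by (auto simp: y_def tr_def step_def entry_eq_def)
      have subst: "entry_eq D V (cs_subst V p Q y i) (cs_subst V p Q y i)" for i
        using y_in by (intro cs_subst const) auto
      have res: "residual V p Q y m holomorphic_on D" for m
        unfolding residual_def using y_in[of "m - p"] subst[of "m - p"] D
        by (auto simp: entry_eq_def intro!: holomorphic_intros)
      have "forcing V p Q y n \<in> fast_space V"
        using subst[of "n - 1"] False by (simp add: forcing_def entry_eq_def)
      from ex_fast_solution[OF this, of "\<lambda>\<nu>. (shift_S ^^ (p - 1 - \<nu>)) (residual V p Q y (n + \<nu>)) 0 / of_nat p"]
      obtain g where g: "g \<in> fast_space V"
        "\<And>\<nu>. 0 < \<nu> \<Longrightarrow> \<nu> < p \<Longrightarrow> asym_coeff V g \<nu> = (shift_S ^^ (p - 1 - \<nu>)) (residual V p Q y (n + \<nu>)) 0 / of_nat p"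
        "\<And>X. X \<in> V \<Longrightarrow> (g has_field_derivative of_nat p * X ^ (p - 1) * g X
          - of_nat p * (\<Sum>\<nu>=1..p - 1. (shift_S ^^ (p - 1 - \<nu>)) (residual V p Q y (n + \<nu>)) 0 / of_nat p * X ^ (p - 1 - \<nu>))
          + forcing V p Q y n X) (at X)"
        by blast
      define a where "a = (\<lambda>x. (shift_S ^^ (p - 1)) (residual V p Q y n) x / of_nat p)"
      \<comment> \<open>Here the provision made at the earlier order m = n-(p-1-l) is used: it is
        exactly the solvability condition for the monomial of degree l. If no such order exists,
        then n < p and both sides are 0.\<close>
      have low: "(shift_S ^^ l) (residual V p Q y n) 0 = of_nat p * fast_coeff V p y n l" if l: "l < p - 1" for l
      proof (cases "p - 1 - l \<le> n")
        case True
        define m where "m = n - (p - 1 - l)"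
        have m: "m < n" "m + (p - 1 - l) = n" "p - 1 - (p - 1 - l) = l" "0 < p - 1 - l" "p - 1 - l < p"
          using l True by (auto simp: m_def)
        have "residual V p Q (tr f m) n = residual V p Q y n"
          by (rule residual_cong) (use m l in \<open>auto simp: y_def tr_def\<close>)
        moreover have "of_nat p * asym_coeff V (snd (f m)) (p - 1 - l)
            = (shift_S ^^ (p - 1 - (p - 1 - l))) (residual V p Q (tr f m) (m + (p - 1 - l))) 0"
          using IH[OF m(1)] m(4,5) unfolding step_def by blast
        moreover have "fast_coeff V p y n l = asym_coeff V (snd (f m)) (p - 1 - l)"
        proof -
          have "y m = f m"
            using m(1) by (simp add: y_def tr_def)
          then show ?thesis
            using True by (simp only: fast_coeff_def m_def if_True)
        qed
        ultimately show ?thesis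
          unfolding m(2,3) by simp
      next
        case False
        then have "residual V p Q y n = (\<lambda>x. 0)" "fast_coeff V p y n l = 0"
          by (auto simp: residual_def fast_coeff_def)
        then show ?thesis
          by (simp add: shift_S_power_zero)
      qed
      have "step f n (a, g)"
        unfolding step_def y_def[symmetric]
      proof (intro conjI allI impI ballI)
        show "fst (a, g) holomorphic_on D"
          using p res D by (auto simp: a_def intro!: holomorphic_intros shift_S_power_holomorphic)
        show "of_nat p * asym_coeff V (snd (a, g)) \<nu> = (shift_S ^^ (p - 1 - \<nu>)) (residual V p Q y (n + \<nu>)) 0"
          if "0 < \<nu> \<and> \<nu> < p" for \<nu>
          using g(2) that p by simp
        show "residual V p Q y n x = of_nat p * x ^ (p - 1) * fst (a, g) x
          + (\<Sum>l<p - 1. of_nat p * fast_coeff V p y n l * x ^ l)" for x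
        proof -
          have "residual V p Q y n x = (\<Sum>l<p - 1. (shift_S ^^ l) (residual V p Q y n) 0 * x ^ l)
              + x ^ (p - 1) * (shift_S ^^ (p - 1)) (residual V p Q y n) x"
            by (rule shift_S_expansion)
          also have "(\<Sum>l<p - 1. (shift_S ^^ l) (residual V p Q y n) 0 * x ^ l)
              = (\<Sum>l<p - 1. of_nat p * fast_coeff V p y n l * x ^ l)"
            by (rule sum.cong) (auto simp: low)
          also have "(shift_S ^^ (p - 1)) (residual V p Q y n) x = of_nat p * a x"
            using p by (simp add: a_def)
          finally show ?thesis
            by (simp add: mult_ac)
        qed
        show "deriv (snd (a, g)) X = of_nat p * (shift_T V ^^ (p - 1)) (snd (a, g)) X + forcing V p Q y n X"
          if X: "X \<in> V" for X
        proof -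
          have "(\<Sum>\<nu>=1..p - 1. (shift_S ^^ (p - 1 - \<nu>)) (residual V p Q y (n + \<nu>)) 0 / of_nat p * X ^ (p - 1 - \<nu>))
              = (\<Sum>\<nu>=1..p - 1. asym_coeff V g \<nu> * X ^ (p - 1 - \<nu>))"
            using g(2) by (intro sum.cong) auto
          then show ?thesis
            using DERIV_imp_deriv[OF g(3)[OF X]] unfolding snd_conv shift_T_power_eq[OF infinity_in_V g(1)]
            by (simp only: right_diff_distrib mult.assoc)
        qed
      qed (use False g in auto)
      then show ?thesis ..
    qed
  qed
  then obtain y where y: "\<And>n. step y n (y n)"
    by blast
  have y_in: "fst (y n) holomorphic_on D" "snd (y n) \<in> fast_space V" for n
    using y[of n] by (auto simp: step_def)
  have "residual V p Q (tr y n) n = residual V p Q y n" "forcing V p Q (tr y n) n = forcing V p Q y n"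
    "\<And>l. l < p - 1 \<Longrightarrow> fast_coeff V p (tr y n) n l = fast_coeff V p y n l" for n
    using p by (auto simp: tr_def intro!: residual_cong forcing_cong fast_coeff_cong)
  then have "formal_solution D V p Q y"
    unfolding formal_solution_iff[OF infinity_in_V y_in(2) p] using y by (simp add: step_def)
  moreover have "y \<in> eta_cs_space D V"
    using y_in y[of 0] by (auto simp: eta_cs_space_def cs_space_def step_def)
  ultimately show ?thesis
    unfolding D_def by blast
qed

end

theorem mainTheorem2:
  fixes p :: nat and r0 r2 \<epsilon>0 :: real
  assumes "p \<ge> 2" and "r0 > 0" and "r2 > 0" and "\<epsilon>0 > 0"
  shows "\<exists>\<delta>0>0. \<forall>\<delta>. 0 < \<delta> \<and> \<delta> < \<delta>0 \<longrightarrow>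
    (\<forall>(P :: complex \<times> complex \<times> complex \<Rightarrow> complex) (Q :: nat \<Rightarrow> complex \<times> complex \<Rightarrow> complex)
       (D1 :: complex set) (D2 :: complex set) (\<Sigma> :: complex set)
       (V :: complex set) (\<alpha> :: real) (\<beta> :: real) (\<mu> :: real).
       D1 = ball 0 r0 \<and> D2 = ball 0 r2 \<and> \<Sigma> = sector (- \<delta>) \<delta> (ereal \<epsilon>0) \<and>
       holomorphic3_on P (D1 \<times> D2 \<times> \<Sigma>) \<and> bounded (P ` (D1 \<times> D2 \<times> \<Sigma>)) \<and>
       gevrey1_expansion D1 D2 \<Sigma> P Q \<and>
       \<mu> \<noteq> 0 \<and> - (3 * pi / (2 * real p)) < \<alpha> \<and> \<alpha> < 0 \<and> 0 < \<beta> \<and> \<beta> < 3 * pi / (2 * real p) \<and>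
       V = quasi_sector \<alpha> \<beta> \<infinity> \<mu>
       \<longrightarrow> (\<exists>y \<in> eta_cs_space D1 V. formal_solution D1 V p Q y \<and>
             (\<forall>z \<in> eta_cs_space D1 V. formal_solution D1 V p Q z \<longrightarrow> cs_eq D1 V z y)))"
proof (intro exI[of _ 1] conjI allI impI)
  fix \<delta> :: real and P :: "complex \<times> complex \<times> complex \<Rightarrow> complex"
    and Q :: "nat \<Rightarrow> complex \<times> complex \<Rightarrow> complex" and D1 D2 \<Sigma> V :: "complex set" and \<alpha> \<beta> \<mu> :: real
  assume hyp: "D1 = ball 0 r0 \<and> D2 = ball 0 r2 \<and> \<Sigma> = sector (- \<delta>) \<delta> (ereal \<epsilon>0) \<and>
       holomorphic3_on P (D1 \<times> D2 \<times> \<Sigma>) \<and> bounded (P ` (D1 \<times> D2 \<times> \<Sigma>)) \<and>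
       gevrey1_expansion D1 D2 \<Sigma> P Q \<and>
       \<mu> \<noteq> 0 \<and> - (3 * pi / (2 * real p)) < \<alpha> \<and> \<alpha> < 0 \<and> 0 < \<beta> \<and> \<beta> < 3 * pi / (2 * real p) \<and>
       V = quasi_sector \<alpha> \<beta> \<infinity> \<mu>"
  interpret quasi_sector_equation p \<alpha> \<beta> \<mu> V
    using hyp assms(1) by unfold_locales auto
  have D: "D1 = ball 0 r0" "D2 = ball 0 r2" and "gevrey1_expansion D1 D2 \<Sigma> P Q"
    using hyp by blast+
  then have "holomorphic2_on (Q k) (ball 0 r0 \<times> ball 0 r2)" for k
    by (auto simp: gevrey1_expansion_def)
  \<comment> \<open>Holomorphy of each P_k in both variables enters here, to make its coefficients
    in y holomorphic in x on the whole disc.\<close>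
  then have Q: "y_coeff Q j k holomorphic_on ball 0 r0" for j k
    unfolding y_coeff_def[abs_def] using \<open>r2 > 0\<close> by (rule taylor_coeff_holomorphic)
  obtain y where y: "y \<in> eta_cs_space D1 V" "formal_solution D1 V p Q y"
    using ex_formal_solution[OF \<open>r0 > 0\<close> Q] D by auto
  have "cs_eq D1 V z y" if "z \<in> eta_cs_space D1 V" "formal_solution D1 V p Q z" for z
    using formal_solution_unique[OF \<open>r0 > 0\<close> Q, of y z] that y D by (simp add: eta_cs_space_def)
  with y show "\<exists>y\<in>eta_cs_space D1 V. formal_solution D1 V p Q y \<and>
      (\<forall>z\<in>eta_cs_space D1 V. formal_solution D1 V p Q z \<longrightarrow> cs_eq D1 V z y)"
    by blast
qed simp

end
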